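(* Let $\Gamma$ be a connected finite simplicial graph that admits a tree $2$-spanner $T$. Then the Bestvina--Brady group $BB_\Gamma$ is a right-angled Artin group. More precisely, choosing an arbitrary orientation of each edge of $T$, the Dicks--Leary presentation of $BB_\Gamma$ can be simplified to the standard RAAG presentation with generating set $E(T)$, in which the relators are the commutators $[e,f]$ for those pairs of distinct edges $e,f\in E(T)$ that are contained in a common triangle of $\Gamma$. In particular $BB_\Gamma\cong A_{T^\ast}$, where $T^\ast$ is the dual graph of $T$.
   Context: All graphs are finite simplicial graphs. The right-angled Artin group (RAAG) on $\Gamma$ is $A_\Gamma=\langle V(\Gamma)\mid [v,w] \text{ whenever } (v,w)\in E(\Gamma)\rangle$, and the Bestvina--Brady group $BB_\Gamma$ is the kernel of the homomorphism $A_\Gamma\to\mathbb Z$ sending every vertex generator to $1$. For a connected graph $\Gamma$, the Dicks--Leary presentation of $BB_\Gamma$ has as generators the oriented edges of $\Gamma$ and as relators the words $e_1^n\cdots e_l^n$ for each oriented cycle $(e_1,\dots,e_l)$, $l\ge 2$, and each integer $n\neq 0$ (an edge followed by its reverse counts as an oriented cycle of length $2$). The oriented edge $e$ with initial vertex $\iota e$ and terminal vertex $\tau e$ corresponds to the element $\tau e(\iota e)^{-1}\in A_\Gamma$; reversing the orientation inverts the generator. A tree $2$-spanner of $\Gamma$ is a spanning tree $T$ of $\Gamma$ such that $d_T(x,y)\le 2\,d_\Gamma(x,y)$ for all $x,y\in V(\Gamma)$. The dual graph $T^\ast$ of $T$ (in $\Gamma$) is the graph whose vertices are the edges of $T$,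 two of them being adjacent if and only if the corresponding edges of $T$ are contained in the same triangle of $\Gamma$. *)

theory Defs
  imports
    "HOL-Algebra.Elementary_Groups"
    "Graph_Theory.Pair_Digraph"
    "Graph_Theory.Digraph_Component"
    "Graph_Theory.Shortest_Path"
begin

section \<open>Group presentations\<close>

text \<open>The letter \<open>(s, True)\<close> stands for the generator \<open>s\<close>, the letter \<open>(s, False)\<close> for its inverse.\<close>

type_synonym 'a word = "('a \<times> bool) list"

definition words :: "'a set \<Rightarrow> 'a word set" where
  "words S = lists (S \<times> UNIV)"

definition word_inv :: "'a word \<Rightarrow> 'a word" where
  "word_inv w = rev (map (\<lambda>(s, b). (s, \<not> b)) w)"

definition word_comm :: "'a \<Rightarrow> 'a \<Rightarrow> 'a word" where
  "word_comm s t = [(s, True), (t, True), (s, False), (t, False)]"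

definition letter_power :: "'a \<Rightarrow> int \<Rightarrow> 'a word" where
  "letter_power s n = replicate (nat \<bar>n\<bar>) (s, n > 0)"

text \<open>Two words over \<open>S\<close> are related iff they represent the same element of the group
  with presentation \<open>\<langle>S | R\<rangle>\<close>. Words in \<open>R\<close> using letters outside \<open>S\<close> are ignored; all
  uses below have \<open>R \<subseteq> words S\<close>.\<close>

inductive pres_eq :: "'a set \<Rightarrow> 'a word set \<Rightarrow> 'a word \<Rightarrow> 'a word \<Rightarrow> bool" for S R where
  refl: "w \<in> words S \<Longrightarrow> pres_eq S R w w"
| sym: "pres_eq S R w w' \<Longrightarrow> pres_eq S R w' w"
| trans: "pres_eq S R w w' \<Longrightarrow> pres_eq S R w' w'' \<Longrightarrow> pres_eq S R w w''"
| cancel: "u \<in> words S \<Longrightarrow> v \<in> words S \<Longrightarrow> s \<in> S \<Longrightarrow>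
    pres_eq S R (u @ [(s, b), (s, \<not> b)] @ v) (u @ v)"
| relator: "u \<in> words S \<Longrightarrow> v \<in> words S \<Longrightarrow> r \<in> R \<Longrightarrow> r \<in> words S \<Longrightarrow>
    pres_eq S R (u @ r @ v) (u @ v)"

definition pres_class :: "'a set \<Rightarrow> 'a word set \<Rightarrow> 'a word \<Rightarrow> 'a word set" where
  "pres_class S R w = {w'. pres_eq S R w w'}"

definition presented_group :: "'a set \<Rightarrow> 'a word set \<Rightarrow> 'a word set monoid" where
  "presented_group S R =
     \<lparr> carrier = pres_class S R ` words S,
       monoid.mult = (\<lambda>A B. {w. \<exists>a\<in>A. \<exists>b\<in>B. pres_eq S R (a @ b) w}),
       one = pres_class S R [] \<rparr>"

definition pres_gen :: "'a set \<Rightarrow> 'a word set \<Rightarrow> 'a \<Rightarrow> 'a word set" where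
  "pres_gen S R s = pres_class S R [(s, True)]"

text \<open>\<open>\<langle>S | R\<rangle>\<close> is a presentation of \<open>H\<close> in which the generator \<open>s\<close> stands for the element \<open>f s\<close>.\<close>

definition presents :: "('h, 'm) monoid_scheme \<Rightarrow> 'a set \<Rightarrow> 'a word set \<Rightarrow> ('a \<Rightarrow> 'h) \<Rightarrow> bool" where
  "presents H S R f \<longleftrightarrow>
     (\<exists>\<phi> \<in> iso (presented_group S R) H. \<forall>s\<in>S. \<phi> (pres_gen S R s) = f s)"

text \<open>Simplification of presentations by Tietze moves: exchange the relators for another set
  with the same consequences, or delete a generator \<open>x\<close> together with a relator \<open>x = w\<close>
  where neither \<open>w\<close> nor the remaining relators involve \<open>x\<close>. No move introduces or renames
  generators, so every surviving generator keeps denoting the same group element.\<close>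

inductive tietze_step :: "'a set \<times> 'a word set \<Rightarrow> 'a set \<times> 'a word set \<Rightarrow> bool" where
  relators: "R \<subseteq> words S \<Longrightarrow> R' \<subseteq> words S \<Longrightarrow>
    (\<forall>r\<in>R'. pres_eq S R r []) \<Longrightarrow> (\<forall>r\<in>R. pres_eq S R' r []) \<Longrightarrow>
    tietze_step (S, R) (S, R')"
| generator: "x \<notin> S \<Longrightarrow> w \<in> words S \<Longrightarrow> R \<subseteq> words S \<Longrightarrow>
    tietze_step (insert x S, insert ((x, False) # w) R) (S, R)"

definition pres_simplifies :: "'a set \<times> 'a word set \<Rightarrow> 'a set \<times> 'a word set \<Rightarrow> bool" where
  "pres_simplifies = tietze_step\<^sup>*\<^sup>*"

primrec word_eval :: "('h, 'm) monoid_scheme \<Rightarrow> ('a \<Rightarrow> 'h) \<Rightarrow> 'a word \<Rightarrow> 'h" where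
  "word_eval H f [] = \<one>\<^bsub>H\<^esub>"
| "word_eval H f (l # w) =
     (if snd l then f (fst l) else inv\<^bsub>H\<^esub> f (fst l)) \<otimes>\<^bsub>H\<^esub> word_eval H f w"

text \<open>The homomorphism from a presented group to \<open>H\<close> determined by \<open>s \<mapsto> f s\<close>; meaningful
  when \<open>f\<close> respects the relators, cf. \<open>induced_hom\<close> below.\<close>

definition induced_map :: "('h, 'm) monoid_scheme \<Rightarrow> ('a \<Rightarrow> 'h) \<Rightarrow> 'a word set \<Rightarrow> 'h" where
  "induced_map H f A = the_elem (word_eval H f ` A)"


section \<open>Right-angled Artin groups and Bestvina--Brady groups\<close>

text \<open>A finite simplicial graph is a \<open>pair_graph\<close>: each undirected edge is represented by
  its two orientations, so \<open>parcs G\<close> is the set of oriented edges, with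
  initial vertex \<open>fst\<close> and terminal vertex \<open>snd\<close>.\<close>

definition raag_relators :: "'v pair_pre_digraph \<Rightarrow> 'v word set" where
  "raag_relators G = {word_comm v w | v w. (v, w) \<in> parcs G}"

definition raag :: "'v pair_pre_digraph \<Rightarrow> 'v word set monoid" where
  "raag G = presented_group (pverts G) (raag_relators G)"

definition raag_gen :: "'v pair_pre_digraph \<Rightarrow> 'v \<Rightarrow> 'v word set" where
  "raag_gen G = pres_gen (pverts G) (raag_relators G)"

text \<open>Finite graphs have isomorphic copies on natural numbers, so nothing is lost by
  fixing the vertex type.\<close>

definition is_raag :: "('h, 'm) monoid_scheme \<Rightarrow> bool" where
  "is_raag H \<longleftrightarrow> (\<exists>D :: nat pair_pre_digraph. pair_graph D \<and> H \<cong> raag D)"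

definition bb_group :: "'v pair_pre_digraph \<Rightarrow> 'v word set monoid" where
  "bb_group G =
     (raag G)\<lparr> carrier := kernel (raag G) integer_group (induced_map integer_group (\<lambda>_. 1)) \<rparr>"

definition edge_elem :: "'v pair_pre_digraph \<Rightarrow> 'v \<times> 'v \<Rightarrow> 'v word set" where
  "edge_elem G e = raag_gen G (snd e) \<otimes>\<^bsub>raag G\<^esub> inv\<^bsub>raag G\<^esub> raag_gen G (fst e)"

text \<open>\<open>cycle\<close> asks for a closed arc walk without repeated vertices. In a \<open>pair_graph\<close> such a
  walk has length at least 2, and an edge followed by its reverse is a cycle.\<close>

definition dicks_leary_relators :: "'v pair_pre_digraph \<Rightarrow> ('v \<times> 'v) word set" where
  "dicks_leary_relators G =
     {concat (map (\<lambda>e. letter_power e n) p) | p n. pre_digraph.cycle (with_proj G) p \<and> n \<noteq> 0}"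


section \<open>Tree 2-spanners and dual graphs\<close>

text \<open>The library's \<open>tree\<close> is unsuitable for graphs represented as symmetric digraphs, since
  every edge yields a directed cycle of length 2. Only cycles of length at least 3 are excluded.\<close>

definition spanning_tree_of :: "'v pair_pre_digraph \<Rightarrow> 'v pair_pre_digraph \<Rightarrow> bool" where
  "spanning_tree_of T G \<longleftrightarrow>
     pair_graph T \<and> spanning (with_proj T) (with_proj G) \<and>
     Digraph_Component.connected (with_proj T) \<and>
     \<not> (\<exists>p. pre_digraph.cycle (with_proj T) p \<and> 3 \<le> length p)"

definition graph_dist :: "'v pair_pre_digraph \<Rightarrow> 'v \<Rightarrow> 'v \<Rightarrow> ereal" where
  "graph_dist G x y = wf_digraph.\<mu> (with_proj G) (\<lambda>_. 1) x y"

definition tree_2_spanner :: "'v pair_pre_digraph \<Rightarrow> 'v pair_pre_digraph \<Rightarrow> bool" where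
  "tree_2_spanner T G \<longleftrightarrow>
     spanning_tree_of T G \<and>
     (\<forall>x\<in>pverts G. \<forall>y\<in>pverts G. graph_dist T x y \<le> 2 * graph_dist G x y)"

definition uedges :: "'v pair_pre_digraph \<Rightarrow> 'v set set" where
  "uedges G = (\<lambda>(u, v). {u, v}) ` parcs G"

definition orientation :: "'v pair_pre_digraph \<Rightarrow> ('v set \<Rightarrow> 'v \<times> 'v) \<Rightarrow> bool" where
  "orientation T ori \<longleftrightarrow> (\<forall>e\<in>uedges T. ori e \<in> parcs T \<and> {fst (ori e), snd (ori e)} = e)"

definition in_common_triangle :: "'v pair_pre_digraph \<Rightarrow> 'v set \<Rightarrow> 'v set \<Rightarrow> bool" where
  "in_common_triangle G e f \<longleftrightarrow>
     (\<exists>a b c. (a, b) \<in> parcs G \<and> (b, c) \<in> parcs G \<and> (c, a) \<in> parcs G \<and>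
        e \<subseteq> {a, b, c} \<and> f \<subseteq> {a, b, c})"

definition dual_graph :: "'v pair_pre_digraph \<Rightarrow> 'v pair_pre_digraph \<Rightarrow> 'v set pair_pre_digraph" where
  "dual_graph G T =
     \<lparr> pverts = uedges T,
       parcs = {(e, f). e \<in> uedges T \<and> f \<in> uedges T \<and> e \<noteq> f \<and> in_common_triangle G e f} \<rparr>"


section \<open>Basic facts\<close>

lemma words_simps [simp]:
  "[] \<in> words S"
  "l # w \<in> words S \<longleftrightarrow> fst l \<in> S \<and> w \<in> words S"
  "u @ v \<in> words S \<longleftrightarrow> u \<in> words S \<and> v \<in> words S"
  by (cases l; auto simp: words_def)+

lemma word_inv_in_words [simp]: "w \<in> words S \<Longrightarrow> word_inv w \<in> words S"
  by (induction w) (auto simp: word_inv_def split: prod.splits)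

lemma pres_eq_in_words: "pres_eq S R w w' \<Longrightarrow> w \<in> words S \<and> w' \<in> words S"
  by (induction rule: pres_eq.induct) auto

lemma pres_eq_context:
  assumes "pres_eq S R w w'" "x \<in> words S" "y \<in> words S"
  shows "pres_eq S R (x @ w @ y) (x @ w' @ y)"
  using assms
proof (induction rule: pres_eq.induct)
  case (cancel u v s b)
  then show ?case using pres_eq.cancel[of "x @ u" S "v @ y" s R b] by simp
next
  case (relator u v r)
  then show ?case using pres_eq.relator[of "x @ u" S "v @ y" r R] by simp
qed (auto intro: pres_eq.intros)

lemma pres_eq_append:
  assumes "pres_eq S R u u'" "pres_eq S R v v'"
  shows "pres_eq S R (u @ v) (u' @ v')"
proof -
  have "pres_eq S R (u @ v) (u' @ v)"
    using pres_eq_context[OF assms(1), of "[]" v] pres_eq_in_words[OF assms(2)] by simp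
  moreover have "pres_eq S R (u' @ v) (u' @ v')"
    using pres_eq_context[OF assms(2), of u' "[]"] pres_eq_in_words[OF assms(1)] by simp
  ultimately show ?thesis by (rule pres_eq.trans)
qed

lemma pres_eq_inv_left: "w \<in> words S \<Longrightarrow> pres_eq S R (word_inv w @ w) []"
proof (induction w)
  case Nil
  then show ?case by (simp add: word_inv_def pres_eq.refl)
next
  case (Cons l w)
  obtain s b where l: "l = (s, b)" by (cases l)
  have "pres_eq S R (word_inv w @ [(s, \<not> b), (s, \<not> \<not> b)] @ w) (word_inv w @ w)"
    using Cons.prems l by (intro pres_eq.cancel) auto
  moreover have "word_inv (l # w) @ l # w = word_inv w @ [(s, \<not> b), (s, \<not> \<not> b)] @ w"
    by (simp add: word_inv_def l)
  ultimately show ?case using Cons by (auto intro: pres_eq.trans)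
qed

lemma pres_class_eq_iff:
  "w \<in> words S \<Longrightarrow> pres_class S R w = pres_class S R w' \<longleftrightarrow> pres_eq S R w w'"
  unfolding pres_class_def by (blast intro: pres_eq.intros)

lemma presented_group_mult:
  assumes "u \<in> words S" "v \<in> words S"
  shows "pres_class S R u \<otimes>\<^bsub>presented_group S R\<^esub> pres_class S R v = pres_class S R (u @ v)"
  using assms unfolding presented_group_def pres_class_def
  by (auto intro: pres_eq_append pres_eq.intros)

lemma presented_group_carrier:
  "carrier (presented_group S R) = pres_class S R ` words S"
  by (simp add: presented_group_def)

lemma presented_group_one: "\<one>\<^bsub>presented_group S R\<^esub> = pres_class S R []"
  by (simp add: presented_group_def)

lemma presented_group_is_group: "group (presented_group S R)"
proof (rule groupI)
  fix x assume "x \<in> carrier (presented_group S R)"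
  then obtain w where w: "w \<in> words S" "x = pres_class S R w"
    by (auto simp: presented_group_carrier)
  have "pres_class S R (word_inv w) \<otimes>\<^bsub>presented_group S R\<^esub> x = \<one>\<^bsub>presented_group S R\<^esub>"
    using w by (simp add: presented_group_mult presented_group_one pres_class_eq_iff pres_eq_inv_left)
  then show "\<exists>y\<in>carrier (presented_group S R).
      y \<otimes>\<^bsub>presented_group S R\<^esub> x = \<one>\<^bsub>presented_group S R\<^esub>"
    using w by (auto simp: presented_group_carrier)
qed (auto simp: presented_group_carrier presented_group_mult presented_group_one)

context group
begin

lemma word_eval_closed: "f \<in> S \<rightarrow> carrier G \<Longrightarrow> w \<in> words S \<Longrightarrow> word_eval G f w \<in> carrier G"
  by (induction w) auto

lemma word_eval_append:
  assumes "f \<in> S \<rightarrow> carrier G" "u \<in> words S" "v \<in> words S"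
  shows "word_eval G f (u @ v) = word_eval G f u \<otimes> word_eval G f v"
  using assms(2)
proof (induction u)
  case Nil
  then show ?case using assms by (simp add: word_eval_closed)
next
  case (Cons l u)
  then have "f (fst l) \<in> carrier G" "word_eval G f u \<in> carrier G" "word_eval G f v \<in> carrier G"
    using assms word_eval_closed by auto
  then show ?case using Cons by (simp add: m_assoc)
qed

lemma word_eval_pres_eq:
  assumes "pres_eq S R w w'"
    and f: "f \<in> S \<rightarrow> carrier G" and rel: "\<And>r. r \<in> R \<Longrightarrow> r \<in> words S \<Longrightarrow> word_eval G f r = \<one>"
  shows "word_eval G f w = word_eval G f w'"
  using assms(1)
proof (induction rule: pres_eq.induct)
  case (cancel u v s b)
  have s: "f s \<in> carrier G" using cancel f by auto
  have v: "word_eval G f v \<in> carrier G" using cancel f word_eval_closed by blast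
  have "word_eval G f ([(s, b), (s, \<not> b)] @ v) = word_eval G f v"
    using s v by (cases b) (simp_all add: m_assoc[symmetric])
  then show ?case using cancel f
    by (simp add: word_eval_append[of f S] del: word_eval.simps append_Cons append_Nil)
next
  case (relator u v r)
  then have "word_eval G f v \<in> carrier G" using f word_eval_closed by blast
  then show ?case using relator f rel by (simp add: word_eval_append[of f S])
qed auto

text \<open>The universal property of \<open>\<langle>S | R\<rangle>\<close>.\<close>

lemma
  assumes f: "f \<in> S \<rightarrow> carrier G" and rel: "\<And>r. r \<in> R \<Longrightarrow> r \<in> words S \<Longrightarrow> word_eval G f r = \<one>"
  shows induced_map_class:
      "w \<in> words S \<Longrightarrow> induced_map G f (pres_class S R w) = word_eval G f w"
    and induced_hom: "induced_map G f \<in> hom (presented_group S R) G"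
    and induced_map_gen: "s \<in> S \<Longrightarrow> induced_map G f (pres_gen S R s) = f s"
proof -
  show 1: "induced_map G f (pres_class S R w) = word_eval G f w" if "w \<in> words S" for w
  proof -
    have "word_eval G f ` pres_class S R w = {word_eval G f w}"
      using word_eval_pres_eq[OF _ f rel] pres_eq.refl[OF that]
      by (force simp: pres_class_def)
    then show ?thesis by (simp add: induced_map_def)
  qed
  show "induced_map G f \<in> hom (presented_group S R) G"
    using f by (auto simp: hom_def presented_group_carrier presented_group_mult 1
        word_eval_closed word_eval_append[of f S])
  show "induced_map G f (pres_gen S R s) = f s" if "s \<in> S"
  proof -
    have "f s \<in> carrier G" using f that by auto
    then show ?thesis using that 1[of "[(s, True)]"] by (simp add: pres_gen_def)
  qed
qed

end

lemma raag_is_group: "group (raag G)"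
  by (simp add: raag_def presented_group_is_group)

text \<open>The map whose kernel defines \<open>bb_group\<close> is the homomorphism sending each vertex to 1.\<close>

lemma
  shows height_hom: "induced_map integer_group (\<lambda>_. 1) \<in> hom (raag G) integer_group"
    and height_gen: "v \<in> pverts G \<Longrightarrow> induced_map integer_group (\<lambda>_. 1) (raag_gen G v) = 1"
proof -
  interpret Z: group integer_group by (rule group_integer_group)
  have inv1: "inv\<^bsub>integer_group\<^esub> (1::int) = -1"
    by (rule Z.inv_equality) auto
  have "word_eval integer_group (\<lambda>_. 1) r = \<one>\<^bsub>integer_group\<^esub>" if "r \<in> raag_relators G" for r
    using that by (auto simp: raag_relators_def word_comm_def inv1)
  then show "induced_map integer_group (\<lambda>_. 1) \<in> hom (raag G) integer_group"
    and "v \<in> pverts G \<Longrightarrow> induced_map integer_group (\<lambda>_. 1) (raag_gen G v) = 1"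
    unfolding raag_def raag_gen_def by (auto intro!: Z.induced_hom Z.induced_map_gen)
qed

lemma bb_group_is_group: "group (bb_group G)"
proof -
  interpret group_hom "raag G" integer_group "induced_map integer_group (\<lambda>_. 1)"
    by (simp add: group_hom_def group_hom_axioms_def height_hom raag_is_group)
  show ?thesis
    unfolding bb_group_def using subgroup_kernel raag_is_group by (intro subgroup.subgroup_is_group)
qed

lemma dual_graph_is_graph:
  assumes "pair_graph T"
  shows "pair_graph (dual_graph G T)"
proof -
  interpret pair_graph T by fact
  have fin: "finite (uedges T)" by (simp add: uedges_def pair_finite_arcs)
  have "parcs (dual_graph G T) \<subseteq> uedges T \<times> uedges T" by (auto simp: dual_graph_def)
  then have "finite (parcs (dual_graph G T))" using fin finite_subset by blast
  moreover have "sym (parcs (dual_graph G T))"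
    by (auto simp: dual_graph_def sym_def in_common_triangle_def)
  ultimately show ?thesis
    using fin by unfold_locales (auto simp: dual_graph_def symmetric_def)
qed

end

theory Submission
  imports Defs
begin

text \<open>
  Let \<open>P\<close> be the Artin group of the dual graph. Products along walks in the tree define
  potentials \<open>p v\<close> and \<open>q v\<close> in \<open>P\<close> (multiplying from the left and from the right), which stand
  for \<open>v r\<^sup>-\<^sup>1\<close> and \<open>r\<^sup>-\<^sup>1 v\<close> for a root vertex \<open>r\<close>. In terms of them one writes down an automorphism
  of \<open>P\<close> that must agree with conjugation by \<open>r\<close>; then the vertex \<open>v\<close> acts on \<open>P\<close> by this
  automorphism followed by left multiplication with \<open>p v\<close>. Adjacent vertices act by commuting
  permutations, because arcs of the graph outside the tree close up a triangle with two tree edges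
  that commute in \<open>P\<close>. So the Artin group of the graph acts on \<open>P\<close>, and the image
  in it of an element \<open>x\<close> of \<open>P\<close> acts by left multiplication with \<open>x\<close>. This makes the map from \<open>P\<close>
  injective; since every element of the Artin group is a product of an image
  and a power of \<open>r\<close>, its image is the Bestvina--Brady group.

  The relators of the 2-cycles and triangles suffice to express every generator
  of the Dicks--Leary presentation by tree edges and to make tree edges in a common triangle commute.
  All other Dicks--Leary relators are consequences, as they hold in the Bestvina--Brady group.
\<close>

section \<open>Presentations of subgroups\<close>

declare pres_eq.trans [trans]

lemma pres_gen_closed: "s \<in> S \<Longrightarrow> pres_gen S R s \<in> carrier (presented_group S R)"
  by (simp add: pres_gen_def presented_group_carrier)

lemma inv_pres_gen:
  assumes "s \<in> S"
  shows "inv\<^bsub>presented_group S R\<^esub> pres_gen S R s = pres_class S R [(s, False)]"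
proof -
  interpret group "presented_group S R" by (rule presented_group_is_group)
  have "pres_eq S R [(s, False), (s, True)] []"
    using assms pres_eq.cancel[of "[]" S "[]" s R False] by simp
  then show ?thesis
    using assms by (intro inv_equality)
      (simp_all add: pres_gen_def presented_group_carrier presented_group_mult
        presented_group_one pres_class_eq_iff image_eqI[OF HOL.refl])
qed

text \<open>Multiplication of classes is concatenation of representatives, so evaluating a word at
  the generators reassembles it. This translates between relations of words and identities in the
  presented group.\<close>

lemma word_eval_pres_gen:
  assumes "w \<in> words S"
  shows "word_eval (presented_group S R) (pres_gen S R) w = pres_class S R w"
  using assms
proof (induction w)
  case Nil
  then show ?case by (simp add: presented_group_one)
next
  case (Cons l w)
  obtain s b where "l = (s, b)" by (cases l)
  then show ?case
    using Cons presented_group_mult[of "[(s, b)]" S w R]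
    by (cases b) (simp_all add: inv_pres_gen, simp_all add: pres_gen_def)
qed

lemma pres_eq_Nil_iff:
  assumes "w \<in> words S"
  shows "pres_eq S R w [] \<longleftrightarrow>
    word_eval (presented_group S R) (pres_gen S R) w = \<one>\<^bsub>presented_group S R\<^esub>"
  using assms by (simp add: word_eval_pres_gen presented_group_one pres_class_eq_iff)

text \<open>Each class has a word as representative, and words are built letter by letter. Later
  inductions can thus be stated with group operations only.\<close>

lemma presented_group_induct [consumes 1, case_names one gen inv]:
  assumes "x \<in> carrier (presented_group S R)"
    and "P \<one>\<^bsub>presented_group S R\<^esub>"
    and "\<And>s x. s \<in> S \<Longrightarrow> x \<in> carrier (presented_group S R) \<Longrightarrow> P x \<Longrightarrow>
      P (pres_gen S R s \<otimes>\<^bsub>presented_group S R\<^esub> x)"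
    and "\<And>s x. s \<in> S \<Longrightarrow> x \<in> carrier (presented_group S R) \<Longrightarrow> P x \<Longrightarrow>
      P (inv\<^bsub>presented_group S R\<^esub> pres_gen S R s \<otimes>\<^bsub>presented_group S R\<^esub> x)"
  shows "P x"
proof -
  have "P (pres_class S R w)" if "w \<in> words S" for w
    using that
  proof (induction w)
    case Nil
    then show ?case using assms(2) by (simp add: presented_group_one)
  next
    case (Cons l w)
    then have w: "pres_class S R w \<in> carrier (presented_group S R)" "P (pres_class S R w)"
      by (simp_all add: presented_group_carrier)
    have "pres_class S R (l # w) = word_eval (presented_group S R) (pres_gen S R) (l # w)"
      using Cons.prems by (simp only: word_eval_pres_gen)
    then show ?case using assms(3,4) w Cons.prems by (simp add: word_eval_pres_gen)
  qed
  then show ?thesis using assms(1) by (auto simp: presented_group_carrier)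
qed

lemma presented_group_hom_eqI:
  assumes h: "group H" "\<phi> \<in> hom (presented_group S R) H" "\<psi> \<in> hom (presented_group S R) H"
    and gen: "\<And>s. s \<in> S \<Longrightarrow> \<phi> (pres_gen S R s) = \<psi> (pres_gen S R s)"
    and x: "x \<in> carrier (presented_group S R)"
  shows "\<phi> x = \<psi> x"
proof -
  interpret \<phi>: group_hom "presented_group S R" H \<phi>
    using h presented_group_is_group by (auto simp: group_hom_def group_hom_axioms_def)
  interpret \<psi>: group_hom "presented_group S R" H \<psi>
    using h presented_group_is_group by (auto simp: group_hom_def group_hom_axioms_def)
  show ?thesis
    using x by (induction rule: presented_group_induct) (simp_all add: pres_gen_closed gen)
qed

text \<open>A derivation over \<open>E\<close> is replayed over \<open>S\<close>: cancellations stay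
  legal, and each use of a relator from \<open>C\<close> is replaced by its own derivation, placed
  in context.\<close>

lemma pres_eq_subset_imp:
  assumes "pres_eq E C w w'" "E \<subseteq> S" "\<And>c. c \<in> C \<Longrightarrow> c \<in> words E \<Longrightarrow> pres_eq S R c []"
  shows "pres_eq S R w w'"
proof -
  have sub: "w \<in> words S" if "w \<in> words E" for w
    using that assms(2) by (auto simp: words_def)
  show ?thesis
    using assms(1)
  proof (induction rule: pres_eq.induct)
    case (relator u v c)
    then have "pres_eq S R (u @ c @ v) (u @ [] @ v)"
      using assms(3) sub by (intro pres_eq_context) auto
    then show ?case by simp
  next
    case (cancel u v s b)
    then show ?case using assms(2) sub by (intro pres_eq.cancel) auto
  qed (use sub in \<open>auto intro: pres_eq.intros\<close>)
qed

text \<open>Starting from \<open>word_inv w\<close>, insert \<open>s\<close> followed by its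
  inverse, replace \<open>s\<close> by \<open>w\<close>, and cancel
  \<open>word_inv w @ w\<close>.\<close>

lemma pres_eq_inv_letter:
  assumes "pres_eq S R [(s, True)] w"
  shows "pres_eq S R [(s, False)] (word_inv w)"
proof -
  have w: "s \<in> S" "w \<in> words S" using pres_eq_in_words[OF assms] by auto
  have "pres_eq S R (word_inv w @ [(s, True), (s, \<not> True)] @ []) (word_inv w @ [])"
    using w by (intro pres_eq.cancel) auto
  then have "pres_eq S R (word_inv w) (word_inv w @ [(s, True)] @ [(s, False)])"
    by (simp add: pres_eq.sym)
  also have "pres_eq S R \<dots> (word_inv w @ w @ [(s, False)])"
    using w by (intro pres_eq_context assms) auto
  also have "pres_eq S R (word_inv w @ w @ [(s, False)]) [(s, False)]"
    using pres_eq_append[OF pres_eq_inv_left[OF w(2)] pres_eq.refl[of "[(s, False)]"]] w by simp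
  finally show ?thesis by (rule pres_eq.sym)
qed

text \<open>\<open>\<langle>S | R\<rangle>\<close> presents the subgroup \<open>K\<close> of \<open>G\<close>. Unlike \<open>presents\<close>, all evaluations take
  place in \<open>G\<close>, so no inverses have to be transferred between \<open>K\<close> and \<open>G\<close>.\<close>

definition realizes ::
  "('h, 'm) monoid_scheme \<Rightarrow> 'h set \<Rightarrow> 'a set \<Rightarrow> 'a word set \<Rightarrow> ('a \<Rightarrow> 'h) \<Rightarrow> bool" where
  "realizes G K S R f \<longleftrightarrow>
     f \<in> S \<rightarrow> carrier G \<and> word_eval G f ` words S = K \<and>
     (\<forall>w\<in>words S. word_eval G f w = \<one>\<^bsub>G\<^esub> \<longleftrightarrow> pres_eq S R w [])"

context group
begin

lemma word_eval_comm_eq_one_iff: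
  assumes "f s \<in> carrier G" "f t \<in> carrier G"
  shows "word_eval G f (word_comm s t) = \<one> \<longleftrightarrow> f s \<otimes> f t = f t \<otimes> f s"
proof -
  have "word_eval G f (word_comm s t) = (f s \<otimes> f t) \<otimes> inv (f t \<otimes> f s)"
    using assms by (simp add: word_comm_def m_assoc inv_mult_group)
  then show ?thesis using assms by (metis inv_solve_right' l_one m_closed one_closed)
qed

lemma word_eval_consistent:
  assumes "subgroup K G" "f \<in> S \<rightarrow> K" "w \<in> words S"
  shows "word_eval (G\<lparr>carrier := K\<rparr>) f w = word_eval G f w"
  using assms(3)
proof (induction w)
  case (Cons l w)
  then have "f (fst l) \<in> K" using assms(2) by auto
  then show ?case using Cons assms(1) by (simp add: m_inv_consistent)
qed simp

lemma realizes_generator: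
  assumes "realizes G K S R f" "s \<in> S"
  shows "f s \<in> K"
proof -
  have "word_eval G f [(s, True)] \<in> K" "f s \<in> carrier G"
    using assms unfolding realizes_def by (auto simp del: word_eval.simps)
  then show ?thesis by simp
qed

lemma realizes_relator:
  assumes "realizes G K S R f" "r \<in> R" "r \<in> words S"
  shows "word_eval G f r = \<one>"
  using assms pres_eq.relator[of "[]" S "[]" r R] by (simp add: realizes_def)

lemma realizes_trivial:
  assumes "realizes G K S R f" "w \<in> words S" "word_eval G f w = \<one>"
  shows "pres_eq S R w []"
  using assms unfolding realizes_def by blast

lemma realizes_imp_presents:
  assumes "subgroup K G" and real: "realizes G K S R f"
  shows "presents (G\<lparr>carrier := K\<rparr>) S R f"
proof -
  interpret K: group "G\<lparr>carrier := K\<rparr>" using assms(1) by (rule subgroup_imp_group)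
  have f: "f \<in> S \<rightarrow> K" using realizes_generator[OF real] by auto
  have fK: "f \<in> S \<rightarrow> carrier (G\<lparr>carrier := K\<rparr>)" using f by simp
  have ev: "word_eval (G\<lparr>carrier := K\<rparr>) f w = word_eval G f w" if "w \<in> words S" for w
    using word_eval_consistent[OF assms(1) f that] .
  have rel: "word_eval (G\<lparr>carrier := K\<rparr>) f r = \<one>\<^bsub>G\<lparr>carrier := K\<rparr>\<^esub>" if "r \<in> R" "r \<in> words S" for r
    using that realizes_relator[OF real that] by (simp add: ev)
  note [simp] = K.induced_map_class[OF fK rel] K.induced_map_gen[OF fK rel]
  let ?\<phi> = "induced_map (G\<lparr>carrier := K\<rparr>) f"
  interpret \<phi>: group_hom "presented_group S R" "G\<lparr>carrier := K\<rparr>" ?\<phi>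
    using K.induced_hom[OF fK rel] presented_group_is_group
    by (auto simp: group_hom_def group_hom_axioms_def K.is_group)
  have img: "?\<phi> ` carrier (presented_group S R) = K"
  proof -
    have "?\<phi> ` carrier (presented_group S R) = word_eval G f ` words S"
      by (auto simp: presented_group_carrier image_image ev intro!: image_cong)
    then show ?thesis using real by (simp add: realizes_def)
  qed
  have inj: "inj_on ?\<phi> (carrier (presented_group S R))"
  proof (rule inj_onI)
    fix x y assume xy: "x \<in> carrier (presented_group S R)" "y \<in> carrier (presented_group S R)"
      and eq: "?\<phi> x = ?\<phi> y"
    \<comment> \<open>Injectivity is reduced to a trivial kernel: the quotient of two elements with
      equal images is the class of a word of value one.\<close>
    let ?z = "x \<otimes>\<^bsub>presented_group S R\<^esub> inv\<^bsub>presented_group S R\<^esub> y"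
    have "?z \<in> carrier (presented_group S R)" using xy by simp
    then obtain w where w: "w \<in> words S" "?z = pres_class S R w"
      by (auto simp: presented_group_carrier)
    have "?\<phi> ?z = \<one>\<^bsub>G\<lparr>carrier := K\<rparr>\<^esub>"
      using xy eq K.r_inv[OF \<phi>.hom_closed[of y]] by simp
    then have "word_eval G f w = \<one>" using w by (simp add: ev)
    then have "?z = \<one>\<^bsub>presented_group S R\<^esub>"
      using w real by (simp add: realizes_def presented_group_one pres_class_eq_iff)
    then show "x = y"
      using xy by (metis \<phi>.G.inv_equality \<phi>.G.inv_closed \<phi>.G.inv_inv)
  qed
  have "?\<phi> \<in> iso (presented_group S R) (G\<lparr>carrier := K\<rparr>)"
    using img inj K.induced_hom[OF fK rel] by (simp add: iso_iff)
  then show ?thesis unfolding presents_def by (intro bexI[of _ ?\<phi>]) auto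
qed

text \<open>Once the relators hold, derivable words have equal values; so of the equivalence in
  \<open>realizes\<close> only the completeness of the relators has to be supplied.\<close>

lemma realizesI:
  assumes f: "f \<in> S \<rightarrow> carrier G" and img: "word_eval G f ` words S = K"
    and rel: "\<And>r. r \<in> R \<Longrightarrow> r \<in> words S \<Longrightarrow> word_eval G f r = \<one>"
    and inj: "\<And>w. w \<in> words S \<Longrightarrow> word_eval G f w = \<one> \<Longrightarrow> pres_eq S R w []"
  shows "realizes G K S R f"
  unfolding realizes_def using word_eval_pres_eq[OF _ f rel] assms by fastforce

text \<open>Every new generator is equivalent to a word over the old ones, so a word is trivial
  as soon as its translation is.\<close>

lemma realizes_extend:
  assumes real: "realizes G K E C f" and "E \<subseteq> S" "C \<subseteq> words E"
    and f: "f \<in> S \<rightarrow> carrier G"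
    and rel: "\<And>r. r \<in> R \<Longrightarrow> r \<in> words S \<Longrightarrow> word_eval G f r = \<one>"
    and C: "\<And>c. c \<in> C \<Longrightarrow> pres_eq S R c []"
    and gen: "\<And>s. s \<in> S \<Longrightarrow> \<exists>w\<in>words E. pres_eq S R [(s, True)] w"
  shows "realizes G K S R f"
proof (rule realizesI[OF f _ rel])
  have sub: "words E \<subseteq> words S" using \<open>E \<subseteq> S\<close> by (auto simp: words_def)
  have translate: "\<exists>w'\<in>words E. pres_eq S R w w'" if "w \<in> words S" for w
    using that
  proof (induction w)
    case Nil
    show ?case using pres_eq.refl[of "[]" S R] by (intro bexI[of _ "[]"]) auto
  next
    case (Cons l w)
    obtain s b where l: "l = (s, b)" by (cases l)
    obtain w' where w': "w' \<in> words E" "pres_eq S R w w'" using Cons by auto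
    \<comment> \<open>The hypothesis translates positive letters only; a negative letter becomes the
      inverse word.\<close>
    have "\<exists>v\<in>words E. pres_eq S R [(s, b)] v"
    proof -
      obtain v where "v \<in> words E" "pres_eq S R [(s, True)] v" using gen[of s] Cons l by auto
      then show ?thesis
        using pres_eq_inv_letter[of S R s v] word_inv_in_words[of v E] by (cases b) auto
    qed
    then obtain v where "v \<in> words E" "pres_eq S R [(s, b)] v" by auto
    then show ?case
      using w' pres_eq_append[of S R "[(s, b)]" v w w'] by (intro bexI[of _ "v @ w'"]) (auto simp: l)
  qed
  have eval_eq: "word_eval G f w = word_eval G f w'" if "pres_eq S R w w'" for w w'
    using word_eval_pres_eq[OF that f rel] .
  show "word_eval G f ` words S = K"
  proof -
    have "word_eval G f ` words S = word_eval G f ` words E"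
      using translate eval_eq sub by (fastforce simp: image_iff)
    then show ?thesis using real by (simp add: realizes_def)
  qed
  show "pres_eq S R w []" if w: "w \<in> words S" "word_eval G f w = \<one>" for w
  proof -
    obtain w' where w': "w' \<in> words E" "pres_eq S R w w'" using translate w by auto
    then have "word_eval G f w' = \<one>" using eval_eq[of w w'] w by simp
    \<comment> \<open>Completeness of \<open>C\<close> gives a derivation over \<open>E\<close>,
      which is then replayed over \<open>S\<close>.\<close>
    then have "pres_eq E C w' []" using w' real by (simp add: realizes_def)
    then have "pres_eq S R w' []" using C \<open>E \<subseteq> S\<close> by (auto intro: pres_eq_subset_imp)
    then show ?thesis using w' by (auto intro: pres_eq.trans)
  qed
qed

end

section \<open>Renaming the generators of a presentation\<close>

definition word_map :: "('a \<Rightarrow> 'b) \<Rightarrow> 'a word \<Rightarrow> 'b word" where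
  "word_map g w = map (\<lambda>(s, b). (g s, b)) w"

lemma word_map_simps [simp]:
  "word_map g [] = []"
  "word_map g (l # w) = (g (fst l), snd l) # word_map g w"
  "word_map g (u @ v) = word_map g u @ word_map g v"
  by (auto simp: word_map_def split: prod.splits)

lemma word_map_in_words [simp]: "w \<in> words S \<Longrightarrow> word_map g w \<in> words (g ` S)"
  by (induction w) auto

lemma words_image_eq: "words (g ` S) = word_map g ` words S"
proof (intro equalityI subsetI)
  fix w assume "w \<in> words (g ` S)"
  then show "w \<in> word_map g ` words S"
  proof (induction w)
    case (Cons l w)
    obtain w' where "w' \<in> words S" "w = word_map g w'" using Cons by auto
    moreover obtain s b where "s \<in> S" "l = (g s, b)" using Cons.prems by (cases l) auto
    ultimately have "l # w = word_map g ((s, b) # w') \<and> (s, b) # w' \<in> words S" by simp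
    then show ?case by blast
  qed (auto intro!: image_eqI[of _ _ "[]"])
qed auto

lemma word_map_word_comm [simp]: "word_map g (word_comm s t) = word_comm (g s) (g t)"
  by (simp add: word_comm_def)

lemma word_eval_word_map: "word_eval G f (word_map g w) = word_eval G (\<lambda>s. f (g s)) w"
  by (induction w) auto

lemma word_eval_cong:
  "w \<in> words S \<Longrightarrow> (\<And>s. s \<in> S \<Longrightarrow> f s = f' s) \<Longrightarrow> word_eval G f w = word_eval G f' w"
  by (induction w) auto

lemma pres_eq_map:
  assumes "pres_eq S R w w'"
  shows "pres_eq (g ` S) (word_map g ` R) (word_map g w) (word_map g w')"
  using assms
proof (induction rule: pres_eq.induct)
  case (cancel u v s b)
  then show ?case
    using pres_eq.cancel[of "word_map g u" "g ` S" "word_map g v" "g s" _ b] by simp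
next
  case (relator u v r)
  then show ?case
    using pres_eq.relator[of "word_map g u" "g ` S" "word_map g v"
        "word_map g r" "word_map g ` R"] by simp
qed (auto intro: pres_eq.intros)

text \<open>A word over the new names lifts to a word over the old names with the same value, and
  the derivation found there is pushed forward along \<open>g\<close>.\<close>

lemma (in group) realizes_rename:
  assumes real: "realizes G K S R (\<lambda>s. f (g s))" and "R \<subseteq> words S"
  shows "realizes G K (g ` S) (word_map g ` R) f"
proof (rule realizesI)
  show "f \<in> g ` S \<rightarrow> carrier G" using real by (auto simp: realizes_def)
  show "word_eval G f ` words (g ` S) = K"
    using real by (simp add: realizes_def words_image_eq image_image word_eval_word_map)
  show "word_eval G f r = \<one>" if "r \<in> word_map g ` R" for r
    using that realizes_relator[OF real] \<open>R \<subseteq> words S\<close> by (auto simp: word_eval_word_map)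
  show "pres_eq (g ` S) (word_map g ` R) w []"
    if w: "w \<in> words (g ` S)" "word_eval G f w = \<one>" for w
  proof -
    obtain v where v: "v \<in> words S" "w = word_map g v"
      using w(1) unfolding words_image_eq by (elim imageE) (rule that)
    then have "pres_eq S R v []" using w(2) real by (simp add: realizes_def word_eval_word_map)
    then show ?thesis using pres_eq_map[of S R v "[]" g] v by simp
  qed
qed

lemma realizes_cong:
  assumes "realizes G K S R f" "\<And>s. s \<in> S \<Longrightarrow> f s = f' s"
  shows "realizes G K S R f'"
proof -
  have "word_eval G f w = word_eval G f' w" if "w \<in> words S" for w
    using that assms(2) by (rule word_eval_cong)
  then show ?thesis
    using assms unfolding realizes_def by (auto simp: Pi_iff image_iff) 
qed

lemma presents_imp_iso: "presents H S R f \<Longrightarrow> presented_group S R \<cong> H"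
  by (auto simp: presents_def is_iso_def)

section \<open>Simplification of presentations\<close>

text \<open>Each generator in \<open>X\<close> is deleted by means of its own defining relator. As
  every \<open>w x\<close> is a word over \<open>E\<close>, the defining relators of the other
  generators do not involve \<open>x\<close>.\<close>

lemma pres_simplifies_generators:
  assumes "finite X" "X \<inter> E = {}" "C \<subseteq> words E" "\<And>x. x \<in> X \<Longrightarrow> w x \<in> words E"
  shows "pres_simplifies (X \<union> E, (\<lambda>x. (x, False) # w x) ` X \<union> C) (E, C)"
  using assms
proof (induction X)
  case empty
  then show ?case by (simp add: pres_simplifies_def)
next
  case (insert x X)
  have sub: "v \<in> words (X \<union> E)" if "v \<in> words E" for v using that by (auto simp: words_def)
  have "tietze_step (insert x (X \<union> E), insert ((x, False) # w x) ((\<lambda>x. (x, False) # w x) ` X \<union> C))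
      (X \<union> E, (\<lambda>x. (x, False) # w x) ` X \<union> C)"
    using insert.hyps insert.prems sub by (intro tietze_step.generator) auto
  then show ?case
    using insert unfolding pres_simplifies_def by (auto intro: converse_rtranclp_into_rtranclp)
qed

text \<open>If two presentations of the same subgroup assign the same elements to the generators,
  their relators have the same consequences.\<close>

lemma (in group) realizes_imp_simplifies:
  assumes E: "realizes G K E C f" "E \<subseteq> S" "C \<subseteq> words E" and "finite (S - E)"
    and S: "realizes G K S R f" "R \<subseteq> words S"
    and gen: "\<And>s. s \<in> S \<Longrightarrow> \<exists>w\<in>words E. pres_eq S R [(s, True)] w"
  shows "pres_simplifies (S, R) (E, C)"
proof -
  have f: "f \<in> S \<rightarrow> carrier G" using S by (simp add: realizes_def)
  have sub: "words E \<subseteq> words S" using \<open>E \<subseteq> S\<close> by (auto simp: words_def)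
  obtain w where w: "\<And>s. s \<in> S \<Longrightarrow> w s \<in> words E" "\<And>s. s \<in> S \<Longrightarrow> pres_eq S R [(s, True)] (w s)"
    using gen by metis
  have eval_w: "word_eval G f (w s) = f s" if "s \<in> S" for s
  proof -
    have "f s \<in> carrier G" using that f by auto
    then show ?thesis
      using word_eval_pres_eq[OF w(2)[OF that] f] realizes_relator[OF S(1)] by simp
  qed
  \<comment> \<open>The intermediate presentation keeps all generators: to the relators of the small
    presentation it adds one relator defining each generator that is to disappear.\<close>
  define R' where "R' = (\<lambda>x. (x, False) # w x) ` (S - E) \<union> C"
  have R': "R' \<subseteq> words S"
    using subsetD[OF sub w(1)] sub \<open>C \<subseteq> words E\<close> by (auto simp: R'_def)
  have R'_one: "word_eval G f r = \<one>" if "r \<in> R'" for r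
  proof (cases "r \<in> C")
    case True
    then show ?thesis using realizes_relator[OF E(1)] \<open>C \<subseteq> words E\<close> by blast
  next
    case False
    then obtain x where x: "x \<in> S" "r = (x, False) # w x"
      using \<open>r \<in> R'\<close> unfolding R'_def by blast
    moreover from x have "f x \<in> carrier G" using f by auto
    ultimately show ?thesis by (simp add: eval_w)
  qed
  have S': "realizes G K S R' f"
  proof (rule realizes_extend[OF E f])
    show "pres_eq S R' c []" if "c \<in> C" for c
      using that R' pres_eq.relator[of "[]" S "[]" c R'] by (auto simp: R'_def)
    show "\<exists>v\<in>words E. pres_eq S R' [(s, True)] v" if "s \<in> S" for s
    proof (cases "s \<in> E")
      case True
      then show ?thesis using that by (auto intro!: bexI[of _ "[(s, True)]"] pres_eq.refl)
    next
      case False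
      \<comment> \<open>The word consisting of \<open>s\<close>, its inverse and \<open>w s\<close>
        is shortened in two ways: the defining relator leaves \<open>s\<close>, the inverse pair
        leaves \<open>w s\<close>.\<close>
      then have "pres_eq S R' ([(s, True)] @ ((s, False) # w s) @ []) ([(s, True)] @ [])"
        using that R' by (intro pres_eq.relator) (auto simp: R'_def)
      then have 1: "pres_eq S R' ((s, True) # (s, False) # w s) [(s, True)]" by simp
      have "pres_eq S R' ([] @ [(s, True), (s, \<not> True)] @ w s) ([] @ w s)"
        using that subsetD[OF sub w(1)] by (intro pres_eq.cancel) auto
      then have "pres_eq S R' ((s, True) # (s, False) # w s) (w s)" by simp
      from pres_eq.trans[OF pres_eq.sym[OF 1] this] show ?thesis using w(1)[OF that] by (rule bexI)
    qed
  qed (rule R'_one)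
  \<comment> \<open>Both relator sets are complete for the words of value one, so one exchange of
    relators suffices.\<close>
  have "tietze_step (S, R) (S, R')"
  proof (rule tietze_step.relators[OF S(2) R'])
    show "\<forall>r\<in>R'. pres_eq S R r []"
      using realizes_trivial[OF S(1) subsetD[OF R'] R'_one] by blast
    show "\<forall>r\<in>R. pres_eq S R' r []"
      using realizes_trivial[OF S' _ realizes_relator[OF S(1)]] S(2) by blast
  qed
  moreover have "pres_simplifies (S, R') (E, C)"
  proof -
    have "S - E \<union> E = S" "(S - E) \<inter> E = {}" using \<open>E \<subseteq> S\<close> by auto
    with pres_simplifies_generators[OF \<open>finite (S - E)\<close> _ \<open>C \<subseteq> words E\<close>, of w] w(1)
    show ?thesis unfolding R'_def by simp
  qed
  ultimately show ?thesis
    unfolding pres_simplifies_def by (rule converse_rtranclp_into_rtranclp[of tietze_step])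
qed

section \<open>Potentials on trees\<close>

lemma (in pair_graph) arc_sym: "(u, v) \<in> parcs G \<Longrightarrow> (v, u) \<in> parcs G"
  using pair_sym_arcs by (auto simp: symmetric_def dest: symD)

text \<open>Connectedness is defined through the symmetric closure, which adds nothing to a
  symmetric arc set, so it provides directed walks.\<close>

lemma (in pair_graph) connected_awalk:
  assumes "Digraph_Component.connected (with_proj G)" "u \<in> pverts G" "v \<in> pverts G"
  shows "\<exists>p. awalk u p v"
proof -
  have "u \<rightarrow>\<^sup>*\<^bsub>mk_symmetric (with_proj G)\<^esub> v"
    using assms by (simp add: connected_def strongly_connected_def)
  then have "u \<rightarrow>\<^sup>*\<^bsub>with_proj G\<^esub> v"
    using reachable_mk_symmetric_eq[OF pair_sym_arcs] by simp
  then show ?thesis using reachable_awalk by simp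
qed

lemma (in pair_graph) connected_induct [consumes 3, case_names root arc]:
  assumes "Digraph_Component.connected (with_proj G)" "r \<in> pverts G" "v \<in> pverts G"
    and "P r" "\<And>u v. (u, v) \<in> parcs G \<Longrightarrow> P u \<Longrightarrow> P v"
  shows "P v"
proof -
  obtain p where "awalk r p v" using connected_awalk[OF assms(1-3)] by blast
  with \<open>P r\<close> show ?thesis
  proof (induction p arbitrary: r)
    case (Cons e p)
    then obtain w where "(r, w) \<in> parcs G" "awalk w p v" by (cases e) (auto simp: awalk_simps)
    then show ?case using Cons.IH Cons.prems assms(5) by blast
  qed (simp add: awalk_Nil_iff)
qed

text \<open>The first arc contributes the rightmost factor. With \<open>d (u, v)\<close> standing
  for \<open>v u^-1\<close>, the product then telescopes to the last vertex times the inverse of the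
  first.\<close>

primrec walk_value :: "('h, 'm) monoid_scheme \<Rightarrow> ('e \<Rightarrow> 'h) \<Rightarrow> 'e list \<Rightarrow> 'h" where
  "walk_value H d [] = \<one>\<^bsub>H\<^esub>"
| "walk_value H d (e # p) = walk_value H d p \<otimes>\<^bsub>H\<^esub> d e"

lemma (in group) walk_value_closed:
  "d \<in> A \<rightarrow> carrier G \<Longrightarrow> set p \<subseteq> A \<Longrightarrow> walk_value G d p \<in> carrier G"
  by (induction p) auto

lemma (in group) walk_value_append:
  assumes "d \<in> A \<rightarrow> carrier G" "set p \<subseteq> A" "set q \<subseteq> A"
  shows "walk_value G d (p @ q) = walk_value G d q \<otimes> walk_value G d p"
  using assms(2)
proof (induction p)
  case Nil
  then show ?case using assms by (simp add: walk_value_closed)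
next
  case (Cons e p)
  then have "d e \<in> carrier G" "walk_value G d p \<in> carrier G" "walk_value G d q \<in> carrier G"
    using assms walk_value_closed by auto
  then show ?case using Cons by (simp add: m_assoc)
qed

text \<open>A closed walk that is not a cycle contains a shorter closed walk, whose removal leaves
  another one; the only cycles of a tree run along an edge and back.\<close>

lemma (in group) walk_value_closed_walk:
  assumes T: "pair_graph T"
    and acyclic: "\<not> (\<exists>p. pre_digraph.cycle (with_proj T) p \<and> 3 \<le> length p)"
    and d: "d \<in> parcs T \<rightarrow> carrier G" "\<And>u v. (u, v) \<in> parcs T \<Longrightarrow> d (v, u) = inv d (u, v)"
  shows "pre_digraph.awalk (with_proj T) u p u \<Longrightarrow> walk_value G d p = \<one>"
proof (induction p arbitrary: u rule: length_induct)
  case (1 p)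
  interpret T: pair_graph T by fact
  have p: "T.awalk u p u" by fact
  show ?case
  proof (cases p)
    case (Cons e p')
    obtain v where e: "e = (u, v)" using p Cons by (cases e) (auto simp: T.awalk_Cons_iff)
    have p': "T.awalk v p' u" using p Cons e by (simp add: T.awalk_Cons_iff)
    show ?thesis
    proof (cases "distinct (pawalk_verts v p')")
      case True
      then have "T.cycle p" unfolding T.cycle_def using p Cons e by auto
      with acyclic have "length p < 3" by auto
      \<comment> \<open>A walk of length one would be a loop, so exactly two arcs remain: an edge
        and its reverse.\<close>
      moreover have "p' \<noteq> []" using p Cons e T.pair_no_loops[of e] by (auto simp: T.awalk_simps)
      ultimately obtain e' where "p' = [e']" using Cons by (cases p'; cases "tl p'") auto
      then have "p = [(u, v), (v, u)]" "(u, v) \<in> parcs T"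
        using p Cons e by (auto simp: T.awalk_simps)
      moreover from this have "d (u, v) \<in> carrier G" using d(1) by auto
      ultimately show ?thesis using d(2) by simp
    next
      case False
      then obtain q r s w where qrs: "p' = q @ r @ s" "0 < length r"
        and w: "T.awalk v q w" "T.awalk w r w" "T.awalk w s u"
        using T.awalk_not_distinct_decomp[OF p'] by blast
      have "T.awalk u ((e # q) @ s) u"
        using w p Cons e by (auto simp: T.awalk_Cons_iff intro: T.awalk_appendI)
      moreover have "length ((e # q) @ s) < length p" "length r < length p"
        using qrs Cons by auto
      ultimately have "walk_value G d ((e # q) @ s) = \<one>" "walk_value G d r = \<one>"
        using 1(1) w(2) by blast+
      moreover have sub: "set (e # q) \<subseteq> parcs T" "set r \<subseteq> parcs T" "set s \<subseteq> parcs T"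
        using p Cons qrs by (auto simp: T.awalk_def)
      moreover have "p = (e # q) @ (r @ s)" using Cons qrs by simp
      ultimately show ?thesis
        using walk_value_closed[OF d(1)]
        by (simp add: walk_value_append[OF d(1)] del: append_Cons walk_value.simps)
    qed
  qed simp
qed

text \<open>Closed walks in a tree have value one, so the value of a walk from \<open>r\<close>
  depends on its end point only and can serve as the potential there.\<close>

lemma (in group) tree_potential:
  assumes T: "pair_graph T" and conn: "Digraph_Component.connected (with_proj T)"
    and acyclic: "\<not> (\<exists>p. pre_digraph.cycle (with_proj T) p \<and> 3 \<le> length p)"
    and d: "d \<in> parcs T \<rightarrow> carrier G" "\<And>u v. (u, v) \<in> parcs T \<Longrightarrow> d (v, u) = inv d (u, v)"
    and r: "r \<in> pverts T"
  obtains p where "p r = \<one>" "p \<in> pverts T \<rightarrow> carrier G"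
    "\<And>u v. (u, v) \<in> parcs T \<Longrightarrow> p v = d (u, v) \<otimes> p u"
proof -
  interpret T: pair_graph T by fact
  define W where "W v = (SOME w. T.awalk r w v)" for v
  have W: "T.awalk r (W v) v" if "v \<in> pverts T" for v
    unfolding W_def using T.connected_awalk[OF conn r that] by (rule someI_ex)
  have subset: "set w \<subseteq> parcs T" if "T.awalk u w v" for u v w
    using that by (auto simp: T.awalk_def)
  have indep: "walk_value G d w = walk_value G d w'" if "T.awalk r w v" "T.awalk r w' v" for v w w'
  proof -
    have "v \<in> pverts T" using that(1) T.awalk_last_in_verts by auto
    \<comment> \<open>A return walk \<open>z\<close> closes up both walks; its common factor is
      cancelled afterwards.\<close>
    then obtain z where z: "T.awalk v z r" using T.connected_awalk[OF conn _ r] by blast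
    have "walk_value G d (w @ z) = \<one>" "walk_value G d (w' @ z) = \<one>"
      using walk_value_closed_walk[OF T acyclic d] T.awalk_appendI that z by blast+
    then have "walk_value G d z \<otimes> walk_value G d w = walk_value G d z \<otimes> walk_value G d w'"
      using that z subset by (simp add: walk_value_append[OF d(1)])
    then show ?thesis using that z subset walk_value_closed[OF d(1)] by simp
  qed
  show ?thesis
  proof
    show "walk_value G d (W r) = \<one>"
      using indep[OF W[OF r], of "[]"] r by (simp add: T.awalk_Nil_iff)
    show "(\<lambda>v. walk_value G d (W v)) \<in> pverts T \<rightarrow> carrier G"
      using W subset walk_value_closed[OF d(1)] by blast
    show "walk_value G d (W v) = d (u, v) \<otimes> walk_value G d (W u)" if "(u, v) \<in> parcs T" for u v
    proof -
      have uv: "u \<in> pverts T" "v \<in> pverts T" using that T.wellformed' by auto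
      then have "T.awalk r (W u @ [(u, v)]) v"
        using W[OF uv(1)] that by (auto intro!: T.awalk_appendI simp: T.awalk_simps)
      then have "walk_value G d (W v) = walk_value G d (W u @ [(u, v)])"
        using indep W uv by blast
      moreover have "d (u, v) \<in> carrier G" using d(1) that by auto
      ultimately show ?thesis
        using subset[OF W[OF uv(1)]] that by (simp add: walk_value_append[OF d(1)])
    qed
  qed
qed

text \<open>Adjacent vertices have distance at most 1 in the graph, hence at most 2 in the tree; the
  absence of loops rules out the empty walk.\<close>

lemma tree_2_spanner_cases:
  assumes "tree_2_spanner T G" "pair_graph G" and uv: "(u, v) \<in> parcs G"
  obtains "(u, v) \<in> parcs T" | m where "(u, m) \<in> parcs T" "(m, v) \<in> parcs T"
proof -
  interpret G: pair_graph G by fact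
  interpret T: pair_graph T
    using assms(1) by (simp add: tree_2_spanner_def spanning_tree_of_def)
  have verts: "u \<in> pverts G" "v \<in> pverts G" using uv G.wellformed' by auto
  have "graph_dist G u v \<le> ereal (G.awalk_cost (\<lambda>_. 1) [(u, v)])"
    unfolding graph_dist_def using uv verts
    by (intro G.min_cost_le_walk_cost) (simp add: G.awalk_simps)
  then have "graph_dist G u v \<le> 1" by (simp add: one_ereal_def)
  then have "2 * graph_dist G u v \<le> 2 * 1" by (intro ereal_mult_left_mono) auto
  moreover have "graph_dist T u v \<le> 2 * graph_dist G u v"
    using assms(1) verts by (simp add: tree_2_spanner_def)
  \<comment> \<open>Because the bound 3 is strict, some walk in the infimum defining the distance
    lies below it. Its length is an integer, so at most 2.\<close>
  ultimately have "graph_dist T u v < 3" by (simp add: order.strict_trans1[of _ 2])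
  then obtain p where p: "T.awalk u p v" "ereal (T.awalk_cost (\<lambda>_. 1) p) < 3"
    unfolding graph_dist_def T.\<mu>_def by (auto simp: INF_less_iff)
  have "T.awalk_cost (\<lambda>_. 1) p = length p" by (induction p) auto
  with p(2) have "length p < 3" by simp
  moreover have "p \<noteq> []" using p(1) uv G.pair_no_loops[of "(u, v)"] by (auto simp: T.awalk_simps)
  ultimately consider e where "p = [e]" | e f where "p = [e, f]"
    by (cases p; cases "tl p"; cases "tl (tl p)") auto
  then show ?thesis
    using p(1) that by cases (auto simp: T.awalk_simps)
qed

section \<open>The Artin group of the dual graph\<close>

context group
begin

lemma commute_inv:
  assumes "x \<otimes> y = y \<otimes> x" "x \<in> carrier G" "y \<in> carrier G"
  shows "inv x \<otimes> y = y \<otimes> inv x"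
proof -
  have "inv x \<otimes> y = inv x \<otimes> (y \<otimes> x) \<otimes> inv x" using assms(2,3) by (simp add: m_assoc)
  also have "\<dots> = inv x \<otimes> (x \<otimes> y) \<otimes> inv x" by (simp only: assms(1))
  also have "\<dots> = y \<otimes> inv x" using assms(2,3) by (simp add: m_assoc[symmetric])
  finally show ?thesis .
qed

text \<open>Inverting either factor preserves commuting. The relators mention one orientation of
  each edge, whereas computations meet both.\<close>

lemma commute_signed:
  assumes "x \<otimes> y = y \<otimes> x" "x \<in> carrier G" "y \<in> carrier G"
    and "x' = x \<or> x' = inv x" "y' = y \<or> y' = inv y"
  shows "x' \<otimes> y' = y' \<otimes> x'"
proof -
  have 1: "x' \<otimes> y = y \<otimes> x'" "x' \<in> carrier G" using assms commute_inv[of x y] by auto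
  then have "inv y \<otimes> x' = x' \<otimes> inv y" using commute_inv[of y x'] assms(3) by simp
  then show ?thesis using 1 assms(5) by auto
qed

text \<open>Conjugation is multiplicative. The bracketing is the one in which the potentials produce
  conjugates.\<close>

lemma conjugate_commute:
  assumes "x \<otimes> y = y \<otimes> x" "x \<in> carrier G" "y \<in> carrier G" "z \<in> carrier G"
  shows "(inv z \<otimes> (x \<otimes> z)) \<otimes> (inv z \<otimes> (y \<otimes> z)) = (inv z \<otimes> (y \<otimes> z)) \<otimes> (inv z \<otimes> (x \<otimes> z))"
proof -
  have "(inv z \<otimes> (a \<otimes> z)) \<otimes> (inv z \<otimes> (b \<otimes> z)) = inv z \<otimes> (a \<otimes> b) \<otimes> z"
    if "a \<in> carrier G" "b \<in> carrier G" for a b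
  proof -
    have "z \<otimes> (inv z \<otimes> (b \<otimes> z)) = b \<otimes> z" using that assms(4) by (simp add: m_assoc[symmetric])
    then show ?thesis using that assms(4) by (simp add: m_assoc)
  qed
  then show ?thesis using assms by simp
qed

end

lemma raag_gen_closed: "v \<in> pverts G \<Longrightarrow> raag_gen G v \<in> carrier (raag G)"
  by (simp add: raag_gen_def raag_def pres_gen_closed)

lemma (in pair_wf_digraph) raag_gen_commute:
  assumes "(v, w) \<in> parcs G"
  shows "raag_gen G v \<otimes>\<^bsub>raag G\<^esub> raag_gen G w = raag_gen G w \<otimes>\<^bsub>raag G\<^esub> raag_gen G v"
proof -
  interpret R: group "raag G" by (rule raag_is_group)
  have vw: "v \<in> pverts G" "w \<in> pverts G" using wellformed' assms by auto
  then have c: "word_comm v w \<in> words (pverts G)" by (simp add: word_comm_def)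
  have "pres_eq (pverts G) (raag_relators G) (word_comm v w) []"
    using pres_eq.relator[of "[]" "pverts G" "[]" "word_comm v w" "raag_relators G"] assms c
    by (auto simp: raag_relators_def)
  then have "word_eval (raag G) (raag_gen G) (word_comm v w) = \<one>\<^bsub>raag G\<^esub>"
    using pres_eq_Nil_iff[OF c] by (simp add: raag_def raag_gen_def)
  then show ?thesis
    using R.word_eval_comm_eq_one_iff[of "raag_gen G" v w] raag_gen_closed[OF vw(1)]
      raag_gen_closed[OF vw(2)] by simp
qed

section \<open>Tree arcs as elements of the dual Artin group\<close>

locale oriented_spanner =
  fixes \<Gamma> T :: "'v pair_pre_digraph" and ori :: "'v set \<Rightarrow> 'v \<times> 'v"
  assumes graph: "pair_graph \<Gamma>"
    and spanner: "tree_2_spanner T \<Gamma>"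
    and oriented: "orientation T ori"
begin

sublocale \<Gamma>: pair_graph \<Gamma> by (rule graph)

sublocale T: pair_graph T
  using spanner by (simp add: tree_2_spanner_def spanning_tree_of_def)

lemma tree_connected: "Digraph_Component.connected (with_proj T)"
  and tree_acyclic: "\<not> (\<exists>p. pre_digraph.cycle (with_proj T) p \<and> 3 \<le> length p)"
  and tree_verts: "pverts T = pverts \<Gamma>"
  and tree_arcs: "parcs T \<subseteq> parcs \<Gamma>"
  using spanner
  by (auto simp: tree_2_spanner_def spanning_tree_of_def spanning_def subgraph_def)

lemma arc_neq: "(u, v) \<in> parcs \<Gamma> \<Longrightarrow> u \<noteq> v"
  using \<Gamma>.pair_no_loops by force

abbreviation dual where "dual \<equiv> dual_graph \<Gamma> T"
abbreviation A where "A \<equiv> raag \<Gamma>"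
abbreviation P where "P \<equiv> raag dual"
abbreviation gv where "gv \<equiv> raag_gen \<Gamma>"
abbreviation ge where "ge \<equiv> raag_gen dual"

sublocale A: group A by (rule raag_is_group)
sublocale P: group P by (rule raag_is_group)

lemma dual_verts: "pverts dual = uedges T" by (simp add: dual_graph_def)

lemma uedge: "(u, v) \<in> parcs T \<Longrightarrow> {u, v} \<in> uedges T"
  by (auto simp: uedges_def)

lemma ge_closed [simp]: "e \<in> uedges T \<Longrightarrow> ge e \<in> carrier P"
  by (simp add: raag_gen_closed dual_verts)

lemma gv_closed [simp]: "v \<in> pverts \<Gamma> \<Longrightarrow> gv v \<in> carrier A"
  by (rule raag_gen_closed)

lemma ori_cases:
  assumes "(u, v) \<in> parcs T"
  shows "ori {u, v} = (u, v) \<or> ori {u, v} = (v, u)"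
proof -
  have "{fst (ori {u, v}), snd (ori {u, v})} = {u, v}"
    using oriented uedge[OF assms] by (auto simp: orientation_def)
  then show ?thesis by (cases "ori {u, v}") (auto simp: doubleton_eq_iff)
qed

lemma ori_arc:
  assumes "e \<in> uedges T"
  obtains u v where "(u, v) \<in> parcs T" "ori e = (u, v)" "e = {u, v}"
proof (rule that)
  show "(fst (ori e), snd (ori e)) \<in> parcs T" "e = {fst (ori e), snd (ori e)}"
    using oriented assms by (simp_all add: orientation_def)
qed simp

text \<open>Two edges inside a set of three vertices must meet in some \<open>m\<close>, and their
  other ends are joined by the third side. All computations with triangles use this shape.\<close>

lemma common_triangleE:
  assumes "e \<in> uedges T" "f \<in> uedges T" "e \<noteq> f" "in_common_triangle \<Gamma> e f"
  obtains m a c where "(m, a) \<in> parcs T" "(m, c) \<in> parcs T" "(a, c) \<in> parcs \<Gamma>"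
    "e = {m, a}" "f = {m, c}"
proof -
  obtain x y z where xyz: "(x, y) \<in> parcs \<Gamma>" "(y, z) \<in> parcs \<Gamma>" "(z, x) \<in> parcs \<Gamma>"
      "e \<subseteq> {x, y, z}" "f \<subseteq> {x, y, z}"
    using assms(4) by (auto simp: in_common_triangle_def)
  obtain a b where ab: "(a, b) \<in> parcs T" "e = {a, b}" using assms(1) by (auto simp: uedges_def)
  obtain c d where cd: "(c, d) \<in> parcs T" "f = {c, d}" using assms(2) by (auto simp: uedges_def)
  have neq: "a \<noteq> b" "c \<noteq> d" using ab cd tree_arcs arc_neq by blast+
  have tri: "(s, t) \<in> parcs \<Gamma>" if "s \<in> {x, y, z}" "t \<in> {x, y, z}" "s \<noteq> t" for s t
    using that xyz(1-3) xyz(1-3)[THEN \<Gamma>.arc_sym] by (elim insertE emptyE) simp_all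
  have "a \<in> {x, y, z}" "b \<in> {x, y, z}" "c \<in> {x, y, z}" "d \<in> {x, y, z}"
    using xyz(4,5) ab(2) cd(2) by simp_all
  then have "a = c \<or> a = d \<or> b = c \<or> b = d"
    using neq by (elim insertE emptyE) simp_all
  moreover have other: "(t, t') \<in> parcs \<Gamma>" if "e = {m, t}" "f = {m, t'}" for m t t'
    using that xyz(4,5) assms(3) by (intro tri) auto
  ultimately consider m t t' where "(m, t) \<in> parcs T" "(m, t') \<in> parcs T" "e = {m, t}" "f = {m, t'}"
  proof (elim disjE)
    assume "a = c" then show thesis using ab cd by (intro that[of a b d]) simp_all
  next
    assume "a = d" then show thesis
      using ab cd T.arc_sym by (intro that[of a b c]) (simp_all add: insert_commute)
  next
    assume "b = c" then show thesis
      using ab cd T.arc_sym by (intro that[of b a d]) (simp_all add: insert_commute)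
  next
    assume "b = d" then show thesis
      using ab cd T.arc_sym by (intro that[of b a c]) (simp_all add: insert_commute)
  qed
  then show ?thesis
  proof cases
    case (1 m t t')
    then show ?thesis using other[of m t t'] by (intro that) simp_all
  qed
qed

text \<open>Stands for \<open>v u^-1\<close>, whichever direction \<open>ori\<close> selects for the
  edge.\<close>

definition arc_elem :: "'v \<times> 'v \<Rightarrow> 'v set word set" where
  "arc_elem = (\<lambda>(u, v). if ori {u, v} = (u, v) then ge {u, v} else inv\<^bsub>P\<^esub> ge {u, v})"

lemma arc_elem_closed [simp]: "(u, v) \<in> parcs T \<Longrightarrow> arc_elem (u, v) \<in> carrier P"
  using uedge by (auto simp: arc_elem_def)

lemma arc_elem_inv:
  assumes "(u, v) \<in> parcs T"
  shows "arc_elem (v, u) = inv\<^bsub>P\<^esub> arc_elem (u, v)"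
proof -
  have "u \<noteq> v" "{v, u} = {u, v}" using tree_arcs arc_neq assms by blast+
  then show ?thesis
    using ori_cases[OF assms] uedge[OF assms] by (elim disjE) (simp_all add: arc_elem_def)
qed

lemma arc_elem_ori: "e \<in> uedges T \<Longrightarrow> arc_elem (ori e) = ge e"
  by (elim ori_arc) (simp add: arc_elem_def)

lemma arc_elem_signed:
  "arc_elem (u, v) = ge {u, v} \<or> arc_elem (u, v) = inv\<^bsub>P\<^esub> ge {u, v}"
  by (auto simp: arc_elem_def)

text \<open>The third side from \<open>a\<close> to \<open>c\<close> puts both edges in one
  triangle, so they are adjacent in the dual graph and their generators commute; signs are
  harmless.\<close>

lemma arc_elem_commute:
  assumes "(m, a) \<in> parcs T" "(m, c) \<in> parcs T" "(a, c) \<in> parcs \<Gamma>"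
  shows "arc_elem (m, a) \<otimes>\<^bsub>P\<^esub> arc_elem (m, c) = arc_elem (m, c) \<otimes>\<^bsub>P\<^esub> arc_elem (m, a)"
proof -
  interpret D: pair_graph dual by (rule dual_graph_is_graph) (rule T.pair_graph_axioms)
  have "a \<noteq> c" using assms(3) arc_neq by blast
  then have "{m, a} \<noteq> {m, c}" by (auto simp: doubleton_eq_iff)
  moreover have "in_common_triangle \<Gamma> {m, a} {m, c}"
    unfolding in_common_triangle_def
    using assms(3) subsetD[OF tree_arcs assms(1)] \<Gamma>.arc_sym[OF subsetD[OF tree_arcs assms(2)]]
    by (intro exI[of _ m] exI[of _ a] exI[of _ c]) simp
  ultimately have "({m, a}, {m, c}) \<in> parcs dual"
    using assms uedge by (simp add: dual_graph_def)
  from P.commute_signed[OF D.raag_gen_commute[OF this] _ _ arc_elem_signed arc_elem_signed]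
  show ?thesis using uedge assms(1,2) by simp
qed

text \<open>The universal property of \<^term>\<open>P\<close>, in a form that does not depend on the orientation.\<close>

lemma
  assumes "group H"
    and h_closed: "\<And>u v. (u, v) \<in> parcs T \<Longrightarrow> h (u, v) \<in> carrier H"
    and h_inv: "\<And>u v. (u, v) \<in> parcs T \<Longrightarrow> h (v, u) = inv\<^bsub>H\<^esub> h (u, v)"
    and h_commute: "\<And>m a c. (m, a) \<in> parcs T \<Longrightarrow> (m, c) \<in> parcs T \<Longrightarrow> (a, c) \<in> parcs \<Gamma> \<Longrightarrow>
      h (m, a) \<otimes>\<^bsub>H\<^esub> h (m, c) = h (m, c) \<otimes>\<^bsub>H\<^esub> h (m, a)"
  shows tree_hom: "induced_map H (\<lambda>e. h (ori e)) \<in> hom P H"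
    and tree_hom_arc: "(u, v) \<in> parcs T \<Longrightarrow> induced_map H (\<lambda>e. h (ori e)) (arc_elem (u, v)) = h (u, v)"
    and tree_hom_class: "w \<in> words (uedges T) \<Longrightarrow>
      induced_map H (\<lambda>e. h (ori e)) (pres_class (uedges T) (raag_relators dual) w) =
      word_eval H (\<lambda>e. h (ori e)) w"
proof -
  interpret H: group H by fact
  have f: "(\<lambda>e. h (ori e)) \<in> uedges T \<rightarrow> carrier H"
  proof
    fix e assume e: "e \<in> uedges T"
    obtain u v where "(u, v) \<in> parcs T" "ori e = (u, v)" using e by (rule ori_arc)
    then show "h (ori e) \<in> carrier H" using h_closed by simp
  qed
  have signed: "h (ori {u, v}) = h (u, v) \<or> h (ori {u, v}) = inv\<^bsub>H\<^esub> h (u, v)"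
    if "(u, v) \<in> parcs T" for u v
    using ori_cases[OF that] h_inv[OF that] by auto
  have rel: "word_eval H (\<lambda>e. h (ori e)) w = \<one>\<^bsub>H\<^esub>" if w: "w \<in> raag_relators dual" for w
  proof -
    obtain e f where ef: "w = word_comm e f" "e \<in> uedges T" "f \<in> uedges T" "e \<noteq> f"
        "in_common_triangle \<Gamma> e f"
      using w by (auto simp: raag_relators_def dual_graph_def)
    obtain m a c where mac: "(m, a) \<in> parcs T" "(m, c) \<in> parcs T" "(a, c) \<in> parcs \<Gamma>"
        "e = {m, a}" "f = {m, c}"
      using ef(2-5) by (rule common_triangleE)
    \<comment> \<open>The chosen orientations may point towards or away from \<open>m\<close>, so
      the hypothesis about arcs leaving \<open>m\<close> applies up to signs.\<close>
    have "h (ori e) \<otimes>\<^bsub>H\<^esub> h (ori f) = h (ori f) \<otimes>\<^bsub>H\<^esub> h (ori e)"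
      unfolding mac(4,5)
      by (rule H.commute_signed[OF h_commute[OF mac(1-3)] h_closed[OF mac(1)] h_closed[OF mac(2)]
            signed[OF mac(1)] signed[OF mac(2)]])
    moreover have "h (ori e) \<in> carrier H" "h (ori f) \<in> carrier H" using f ef by auto
    ultimately show ?thesis
      unfolding ef(1) by (simp add: H.word_eval_comm_eq_one_iff)
  qed
  have P: "P = presented_group (uedges T) (raag_relators dual)"
    by (simp add: raag_def dual_verts)
  let ?F = "induced_map H (\<lambda>e. h (ori e))"
  show hom: "?F \<in> hom P H" unfolding P using rel by (intro H.induced_hom[OF f])
  show "?F (pres_class (uedges T) (raag_relators dual) w) = word_eval H (\<lambda>e. h (ori e)) w"
    if "w \<in> words (uedges T)"
    using that rel by (intro H.induced_map_class[OF f])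
  interpret F: group_hom P H ?F
    using hom by (simp add: group_hom_def group_hom_axioms_def P.is_group H.is_group)
  show "?F (arc_elem (u, v)) = h (u, v)" if uv: "(u, v) \<in> parcs T"
  proof -
    have *: "?F (ge {u, v}) = h (ori {u, v})"
      unfolding raag_gen_def dual_verts using uedge[OF uv]
      by (intro H.induced_map_gen[OF f]) (simp_all add: rel)
    show ?thesis
    proof (cases "ori {u, v} = (u, v)")
      case True
      then show ?thesis using * by (simp add: arc_elem_def)
    next
      case False
      then have "?F (arc_elem (u, v)) = inv\<^bsub>H\<^esub> h (v, u)"
        using * uedge[OF uv] ori_cases[OF uv] by (simp add: arc_elem_def)
      then show ?thesis using h_inv[OF uv] h_closed[OF uv] by simp
    qed
  qed
qed

lemma tree_hom_eqI:
  assumes "group H" "F \<in> hom P H" "F' \<in> hom P H"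
    and "\<And>u v. (u, v) \<in> parcs T \<Longrightarrow> F (arc_elem (u, v)) = F' (arc_elem (u, v))"
    and "x \<in> carrier P"
  shows "F x = F' x"
proof -
  have "F (ge e) = F' (ge e)" if e: "e \<in> uedges T" for e
  proof -
    obtain u v where "(u, v) \<in> parcs T" "ori e = (u, v)" using e by (rule ori_arc)
    then show ?thesis using assms(4)[of u v] arc_elem_ori[OF e] by simp
  qed
  from assms(1-3) this assms(5) show ?thesis
    unfolding raag_def raag_gen_def dual_verts by (rule presented_group_hom_eqI)
qed

text \<open>The two directions of a tree arc account for a generator and its inverse, which merges
  two inductive steps into one.\<close>

lemma presented_P_induct [consumes 1, case_names one arc]:
  assumes "x \<in> carrier P" "Q \<one>\<^bsub>P\<^esub>"
    and "\<And>u v x. (u, v) \<in> parcs T \<Longrightarrow> x \<in> carrier P \<Longrightarrow> Q x \<Longrightarrow> Q (arc_elem (u, v) \<otimes>\<^bsub>P\<^esub> x)"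
  shows "Q x"
proof -
  have arc: "Q (ge e \<otimes>\<^bsub>P\<^esub> x) \<and> Q (inv\<^bsub>P\<^esub> ge e \<otimes>\<^bsub>P\<^esub> x)"
    if e: "e \<in> uedges T" and x: "x \<in> carrier P" "Q x" for e x
  proof -
    obtain u v where uv: "(u, v) \<in> parcs T" "ori e = (u, v)" using e by (rule ori_arc)
    then have "ge e = arc_elem (u, v)" "inv\<^bsub>P\<^esub> ge e = arc_elem (v, u)"
      using arc_elem_ori[OF e] arc_elem_inv by auto
    then show ?thesis using assms(3)[OF uv(1) x] assms(3)[OF T.arc_sym[OF uv(1)] x] by simp
  qed
  show ?thesis
    using assms(1)[unfolded raag_def dual_verts]
  proof (induction rule: presented_group_induct)
    case one
    show ?case using assms(2) by (simp add: raag_def dual_verts)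
  next
    case (gen e x)
    then show ?case using arc[of e x] by (simp add: raag_def raag_gen_def dual_verts)
  next
    case (inv e x)
    then show ?case using arc[of e x] by (simp add: raag_def raag_gen_def dual_verts)
  qed
qed

end

section \<open>Potentials, conjugation by the root, and the map to the Artin group of the
  graph\<close>

lemma (in group) cancel_inv_left:
  assumes "x \<in> carrier G" "y \<in> carrier G"
  shows "x \<otimes> (inv x \<otimes> y) = y" and "inv x \<otimes> (x \<otimes> y) = y"
  using assms by (simp_all add: m_assoc[symmetric])

text \<open>For \<open>q\<close>, read as \<open>r^-1 v\<close>, the factor of an arc stands on the
  right: adjacent vertices commute, so \<open>v u^-1\<close> equals \<open>u^-1 v\<close>, and
  \<open>r^-1 u\<close> times it is \<open>r^-1 v\<close>.\<close>

locale spanner_potential = oriented_spanner +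
  fixes r and p q :: "'a \<Rightarrow> 'a set word set"
  assumes root: "r \<in> pverts \<Gamma>"
    and p_root: "p r = \<one>\<^bsub>P\<^esub>" and p_closed [simp]: "v \<in> pverts \<Gamma> \<Longrightarrow> p v \<in> carrier P"
    and p_arc: "(u, v) \<in> parcs T \<Longrightarrow> p v = arc_elem (u, v) \<otimes>\<^bsub>P\<^esub> p u"
    and q_root: "q r = \<one>\<^bsub>P\<^esub>" and q_closed [simp]: "v \<in> pverts \<Gamma> \<Longrightarrow> q v \<in> carrier P"
    and q_arc: "(u, v) \<in> parcs T \<Longrightarrow> q v = q u \<otimes>\<^bsub>P\<^esub> arc_elem (u, v)"
begin

lemma tree_arc_verts: "(u, v) \<in> parcs T \<Longrightarrow> u \<in> pverts \<Gamma>" "(u, v) \<in> parcs T \<Longrightarrow> v \<in> pverts \<Gamma>"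
  using T.wellformed' tree_verts by auto

lemma gr_closed [simp]: "gv r \<in> carrier A" using root by simp

text \<open>\<open>conj_root\<close> and \<open>conj_root_inv\<close> mirror conjugation by the root vertex and by its inverse.\<close>

definition conj_root where
  "conj_root = induced_map P (\<lambda>e. (\<lambda>(u, v). inv\<^bsub>P\<^esub> p u \<otimes>\<^bsub>P\<^esub> p v) (ori e))"

definition conj_root_inv where
  "conj_root_inv = induced_map P (\<lambda>e. (\<lambda>(u, v). q v \<otimes>\<^bsub>P\<^esub> inv\<^bsub>P\<^esub> q u) (ori e))"

definition embed where
  "embed = induced_map A (\<lambda>e. edge_elem \<Gamma> (ori e))"

text \<open>Conjugating \<open>v u^-1 = u^-1 v\<close> by \<open>r\<close> gives the inverse of
  \<open>u r^-1\<close> times \<open>v r^-1\<close>. The relators are respected because the images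
  of all arcs leaving \<open>m\<close> are their arc elements conjugated by the same element
  \<open>p m\<close>.\<close>

lemma conj_root_hom: "conj_root \<in> hom P P"
  and conj_root_arc: "(u, v) \<in> parcs T \<Longrightarrow> conj_root (arc_elem (u, v)) = inv\<^bsub>P\<^esub> p u \<otimes>\<^bsub>P\<^esub> p v"
proof -
  let ?h = "\<lambda>(u, v). inv\<^bsub>P\<^esub> p u \<otimes>\<^bsub>P\<^esub> p v"
  have 1: "?h (u, v) \<in> carrier P" if "(u, v) \<in> parcs T" for u v
    using that tree_arc_verts by simp
  have 2: "?h (v, u) = inv\<^bsub>P\<^esub> ?h (u, v)" if "(u, v) \<in> parcs T" for u v
    using that tree_arc_verts by (simp add: P.inv_mult_group)
  have 3: "?h (m, a) \<otimes>\<^bsub>P\<^esub> ?h (m, c) = ?h (m, c) \<otimes>\<^bsub>P\<^esub> ?h (m, a)"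
    if "(m, a) \<in> parcs T" "(m, c) \<in> parcs T" "(a, c) \<in> parcs \<Gamma>" for m a c
    using P.conjugate_commute[OF arc_elem_commute[OF that]] that tree_arc_verts
    by (simp add: p_arc[of m])
  show "conj_root \<in> hom P P"
    unfolding conj_root_def by (rule tree_hom[where h = ?h, OF P.is_group 1 2 3])
  show "conj_root (arc_elem (u, v)) = inv\<^bsub>P\<^esub> p u \<otimes>\<^bsub>P\<^esub> p v" if "(u, v) \<in> parcs T"
    using tree_hom_arc[where h = ?h, OF P.is_group 1 2 3 that] by (simp add: conj_root_def)
qed

text \<open>Dually, \<open>r^-1 (v u^-1) r\<close> is \<open>r^-1 v\<close> times the inverse of
  \<open>r^-1 u\<close>, and arcs leaving \<open>m\<close> are conjugated by
  \<open>q m\<close>.\<close>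

lemma conj_root_inv_hom: "conj_root_inv \<in> hom P P"
  and conj_root_inv_arc:
    "(u, v) \<in> parcs T \<Longrightarrow> conj_root_inv (arc_elem (u, v)) = q v \<otimes>\<^bsub>P\<^esub> inv\<^bsub>P\<^esub> q u"
proof -
  let ?h = "\<lambda>(u, v). q v \<otimes>\<^bsub>P\<^esub> inv\<^bsub>P\<^esub> q u"
  have 1: "?h (u, v) \<in> carrier P" if "(u, v) \<in> parcs T" for u v
    using that tree_arc_verts by simp
  have 2: "?h (v, u) = inv\<^bsub>P\<^esub> ?h (u, v)" if "(u, v) \<in> parcs T" for u v
    using that tree_arc_verts by (simp add: P.inv_mult_group)
  have 3: "?h (m, a) \<otimes>\<^bsub>P\<^esub> ?h (m, c) = ?h (m, c) \<otimes>\<^bsub>P\<^esub> ?h (m, a)"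
    if "(m, a) \<in> parcs T" "(m, c) \<in> parcs T" "(a, c) \<in> parcs \<Gamma>" for m a c
    using P.conjugate_commute[OF arc_elem_commute[OF that], of "inv\<^bsub>P\<^esub> q m"] that tree_arc_verts
    by (simp add: q_arc[of m] P.m_assoc)
  show "conj_root_inv \<in> hom P P"
    unfolding conj_root_inv_def by (rule tree_hom[where h = ?h, OF P.is_group 1 2 3])
  show "conj_root_inv (arc_elem (u, v)) = q v \<otimes>\<^bsub>P\<^esub> inv\<^bsub>P\<^esub> q u" if "(u, v) \<in> parcs T"
    using tree_hom_arc[where h = ?h, OF P.is_group 1 2 3 that] by (simp add: conj_root_inv_def)
qed

text \<open>The vertices of a triangle commute pairwise, hence so do \<open>a m^-1\<close> and
  \<open>c m^-1\<close>; this is what the relators of the dual graph require.\<close>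

lemma embed_hom: "embed \<in> hom P A"
  and embed_arc: "(u, v) \<in> parcs T \<Longrightarrow> embed (arc_elem (u, v)) = gv v \<otimes>\<^bsub>A\<^esub> inv\<^bsub>A\<^esub> gv u"
  and embed_class: "w \<in> words (uedges T) \<Longrightarrow>
    embed (pres_class (uedges T) (raag_relators dual) w) = word_eval A (\<lambda>e. edge_elem \<Gamma> (ori e)) w"
proof -
  have 1: "edge_elem \<Gamma> (u, v) \<in> carrier A" if "(u, v) \<in> parcs T" for u v
    using that tree_arc_verts by (simp add: edge_elem_def)
  have 2: "edge_elem \<Gamma> (v, u) = inv\<^bsub>A\<^esub> edge_elem \<Gamma> (u, v)" if "(u, v) \<in> parcs T" for u v
    using that tree_arc_verts by (simp add: edge_elem_def A.inv_mult_group)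
  have 3: "edge_elem \<Gamma> (m, a) \<otimes>\<^bsub>A\<^esub> edge_elem \<Gamma> (m, c) = edge_elem \<Gamma> (m, c) \<otimes>\<^bsub>A\<^esub> edge_elem \<Gamma> (m, a)"
    if mac: "(m, a) \<in> parcs T" "(m, c) \<in> parcs T" "(a, c) \<in> parcs \<Gamma>" for m a c
  proof -
    have [simp]: "gv m \<in> carrier A" "gv a \<in> carrier A" "gv c \<in> carrier A"
      using mac tree_arc_verts by auto
    note com = \<Gamma>.raag_gen_commute[OF subsetD[OF tree_arcs mac(1)]]
      \<Gamma>.raag_gen_commute[OF subsetD[OF tree_arcs mac(2)]] \<Gamma>.raag_gen_commute[OF mac(3)]
    have m: "inv\<^bsub>A\<^esub> gv m \<otimes>\<^bsub>A\<^esub> gv a = gv a \<otimes>\<^bsub>A\<^esub> inv\<^bsub>A\<^esub> gv m"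
      "inv\<^bsub>A\<^esub> gv m \<otimes>\<^bsub>A\<^esub> gv c = gv c \<otimes>\<^bsub>A\<^esub> inv\<^bsub>A\<^esub> gv m"
      by (rule A.commute_inv[OF com(1)] A.commute_inv[OF com(2)]; simp)+
    have *: "(x \<otimes>\<^bsub>A\<^esub> i) \<otimes>\<^bsub>A\<^esub> (y \<otimes>\<^bsub>A\<^esub> i) = (x \<otimes>\<^bsub>A\<^esub> y) \<otimes>\<^bsub>A\<^esub> (i \<otimes>\<^bsub>A\<^esub> i)"
      if "i \<otimes>\<^bsub>A\<^esub> y = y \<otimes>\<^bsub>A\<^esub> i" "x \<in> carrier A" "y \<in> carrier A" "i \<in> carrier A" for x y i
    proof -
      have "(x \<otimes>\<^bsub>A\<^esub> i) \<otimes>\<^bsub>A\<^esub> (y \<otimes>\<^bsub>A\<^esub> i) = x \<otimes>\<^bsub>A\<^esub> (i \<otimes>\<^bsub>A\<^esub> y) \<otimes>\<^bsub>A\<^esub> i"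
        using that(2-4) by (simp add: A.m_assoc)
      then show ?thesis using that by (simp add: A.m_assoc)
    qed
    show ?thesis
      using com(3) *[OF m(1)] *[OF m(2)] by (simp add: edge_elem_def)
  qed
  show "embed \<in> hom P A"
    unfolding embed_def by (rule tree_hom[where h = "edge_elem \<Gamma>", OF A.is_group 1 2 3])
  show "embed (arc_elem (u, v)) = gv v \<otimes>\<^bsub>A\<^esub> inv\<^bsub>A\<^esub> gv u" if "(u, v) \<in> parcs T"
    using tree_hom_arc[where h = "edge_elem \<Gamma>", OF A.is_group 1 2 3 that] by (simp add: embed_def edge_elem_def)
  show "embed (pres_class (uedges T) (raag_relators dual) w) = word_eval A (\<lambda>e. edge_elem \<Gamma> (ori e)) w"
    if "w \<in> words (uedges T)"
    using tree_hom_class[where h = "edge_elem \<Gamma>", OF A.is_group 1 2 3 that] by (simp add: embed_def)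
qed

sublocale \<theta>: group_hom P P conj_root
  by (simp add: group_hom_def group_hom_axioms_def conj_root_hom P.is_group)

sublocale \<psi>: group_hom P P conj_root_inv
  by (simp add: group_hom_def group_hom_axioms_def conj_root_inv_hom P.is_group)

sublocale F: group_hom P A embed
  by (simp add: group_hom_def group_hom_axioms_def embed_hom P.is_group A.is_group)

lemma vertex_induct [consumes 1, case_names root arc]:
  assumes "v \<in> pverts \<Gamma>" "Q r" "\<And>u v. (u, v) \<in> parcs T \<Longrightarrow> Q u \<Longrightarrow> Q v"
  shows "Q v"
  using T.connected_induct[OF tree_connected, of r v Q] assms root tree_verts by blast

text \<open>Conjugating \<open>r^-1 v\<close> by \<open>r\<close> yields \<open>v r^-1\<close>.
  Along a tree arc the new factor \<open>inv (p u) \<otimes> p v\<close> cancels against the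
  \<open>p u\<close> already present.\<close>

lemma conj_root_q: "v \<in> pverts \<Gamma> \<Longrightarrow> conj_root (q v) = p v"
proof (induction rule: vertex_induct)
  case (arc u v)
  then show ?case
    using tree_arc_verts[OF arc(1)] by (simp add: q_arc conj_root_arc P.m_assoc[symmetric])
qed (simp add: p_root q_root)

lemma conj_root_inv_p: "v \<in> pverts \<Gamma> \<Longrightarrow> conj_root_inv (p v) = q v"
proof (induction rule: vertex_induct)
  case (arc u v)
  then show ?case
    using tree_arc_verts[OF arc(1)] by (simp add: p_arc conj_root_inv_arc P.m_assoc)
qed (simp add: p_root q_root)

lemma arc_elem_p: "(u, v) \<in> parcs T \<Longrightarrow> arc_elem (u, v) = p v \<otimes>\<^bsub>P\<^esub> inv\<^bsub>P\<^esub> p u"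
  using tree_arc_verts by (simp add: p_arc P.m_assoc)

lemma arc_elem_q: "(u, v) \<in> parcs T \<Longrightarrow> arc_elem (u, v) = inv\<^bsub>P\<^esub> q u \<otimes>\<^bsub>P\<^esub> q v"
  using tree_arc_verts by (simp add: q_arc P.m_assoc[symmetric])

text \<open>The two maps exchange the potentials \<open>p\<close> and \<open>q\<close>, and each arc
  element is a quotient of values of either potential; so the composite fixes all arc
  elements.\<close>

lemma conj_root_cancel:
  assumes "x \<in> carrier P"
  shows "conj_root (conj_root_inv x) = x"
proof -
  have "(conj_root \<circ> conj_root_inv) x = id x"
  proof (rule tree_hom_eqI[OF P.is_group _ _ _ assms])
    show "conj_root \<circ> conj_root_inv \<in> hom P P"
      by (rule Group.hom_compose[OF conj_root_inv_hom conj_root_hom])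
    show "id \<in> hom P P" by (simp add: hom_def)
    show "(conj_root \<circ> conj_root_inv) (arc_elem (u, v)) = id (arc_elem (u, v))"
      if "(u, v) \<in> parcs T" for u v
      using that arc_elem_p[OF that] tree_arc_verts[OF that]
      by (simp add: conj_root_inv_p conj_root_q)
  qed
  then show ?thesis by simp
qed

lemma conj_root_inv_cancel:
  assumes "x \<in> carrier P"
  shows "conj_root_inv (conj_root x) = x"
proof -
  have "(conj_root_inv \<circ> conj_root) x = id x"
  proof (rule tree_hom_eqI[OF P.is_group _ _ _ assms])
    show "conj_root_inv \<circ> conj_root \<in> hom P P"
      by (rule Group.hom_compose[OF conj_root_hom conj_root_inv_hom])
    show "id \<in> hom P P" by (simp add: hom_def)
    show "(conj_root_inv \<circ> conj_root) (arc_elem (u, v)) = id (arc_elem (u, v))"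
      if "(u, v) \<in> parcs T" for u v
      using that arc_elem_q[OF that] tree_arc_verts[OF that]
      by (simp add: conj_root_inv_p conj_root_q)
  qed
  then show ?thesis by simp
qed

lemma embed_p: "v \<in> pverts \<Gamma> \<Longrightarrow> embed (p v) = gv v \<otimes>\<^bsub>A\<^esub> inv\<^bsub>A\<^esub> gv r"
proof (induction rule: vertex_induct)
  case root
  then show ?case by (simp add: p_root)
next
  case (arc u v)
  have "embed (p v) = (gv v \<otimes>\<^bsub>A\<^esub> inv\<^bsub>A\<^esub> gv u) \<otimes>\<^bsub>A\<^esub> (gv u \<otimes>\<^bsub>A\<^esub> inv\<^bsub>A\<^esub> gv r)"
    using arc tree_arc_verts[OF arc(1)] by (simp add: p_arc embed_arc)
  also have "\<dots> = gv v \<otimes>\<^bsub>A\<^esub> (inv\<^bsub>A\<^esub> gv u \<otimes>\<^bsub>A\<^esub> gv u) \<otimes>\<^bsub>A\<^esub> inv\<^bsub>A\<^esub> gv r"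
    using tree_arc_verts[OF arc(1)] by (simp only: A.m_assoc gv_closed gr_closed A.inv_closed A.m_closed)
  finally show ?case using tree_arc_verts[OF arc(1)] by simp
qed

text \<open>Both sides are homomorphisms in \<open>x\<close>, so tree arcs suffice; there the end
  points commute. This confirms that \<open>conj_root\<close> models conjugation by the
  root.\<close>

lemma embed_conj_root:
  assumes "x \<in> carrier P"
  shows "embed (conj_root x) = gv r \<otimes>\<^bsub>A\<^esub> embed x \<otimes>\<^bsub>A\<^esub> inv\<^bsub>A\<^esub> gv r"
proof -
  have "(embed \<circ> conj_root) x = (\<lambda>x. gv r \<otimes>\<^bsub>A\<^esub> embed x \<otimes>\<^bsub>A\<^esub> inv\<^bsub>A\<^esub> gv r) x"
  proof (rule tree_hom_eqI[OF A.is_group _ _ _ assms])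
    show "embed \<circ> conj_root \<in> hom P A"
      by (rule Group.hom_compose[OF conj_root_hom embed_hom])
    have "(gv r \<otimes>\<^bsub>A\<^esub> a \<otimes>\<^bsub>A\<^esub> inv\<^bsub>A\<^esub> gv r) \<otimes>\<^bsub>A\<^esub> (gv r \<otimes>\<^bsub>A\<^esub> b \<otimes>\<^bsub>A\<^esub> inv\<^bsub>A\<^esub> gv r) =
        gv r \<otimes>\<^bsub>A\<^esub> (a \<otimes>\<^bsub>A\<^esub> b) \<otimes>\<^bsub>A\<^esub> inv\<^bsub>A\<^esub> gv r" if "a \<in> carrier A" "b \<in> carrier A" for a b
    proof -
      have "inv\<^bsub>A\<^esub> gv r \<otimes>\<^bsub>A\<^esub> (gv r \<otimes>\<^bsub>A\<^esub> (b \<otimes>\<^bsub>A\<^esub> inv\<^bsub>A\<^esub> gv r)) = b \<otimes>\<^bsub>A\<^esub> inv\<^bsub>A\<^esub> gv r"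
        using that by (simp add: A.m_assoc[symmetric])
      then show ?thesis using that by (simp add: A.m_assoc)
    qed
    then show "(\<lambda>x. gv r \<otimes>\<^bsub>A\<^esub> embed x \<otimes>\<^bsub>A\<^esub> inv\<^bsub>A\<^esub> gv r) \<in> hom P A"
      by (auto simp: hom_def)
    show "(embed \<circ> conj_root) (arc_elem (u, v)) =
        gv r \<otimes>\<^bsub>A\<^esub> embed (arc_elem (u, v)) \<otimes>\<^bsub>A\<^esub> inv\<^bsub>A\<^esub> gv r"
      if uv: "(u, v) \<in> parcs T" for u v
    proof -
      have [simp]: "gv u \<in> carrier A" "gv v \<in> carrier A" using tree_arc_verts[OF uv] by auto
      have com: "inv\<^bsub>A\<^esub> gv u \<otimes>\<^bsub>A\<^esub> gv v = gv v \<otimes>\<^bsub>A\<^esub> inv\<^bsub>A\<^esub> gv u"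
        using \<Gamma>.raag_gen_commute[of u v] uv tree_arcs by (intro A.commute_inv) auto
      have "embed (conj_root (arc_elem (u, v))) =
          inv\<^bsub>A\<^esub> (gv u \<otimes>\<^bsub>A\<^esub> inv\<^bsub>A\<^esub> gv r) \<otimes>\<^bsub>A\<^esub> (gv v \<otimes>\<^bsub>A\<^esub> inv\<^bsub>A\<^esub> gv r)"
        using tree_arc_verts[OF uv] by (simp add: conj_root_arc[OF uv] embed_p)
      also have "\<dots> = gv r \<otimes>\<^bsub>A\<^esub> (inv\<^bsub>A\<^esub> gv u \<otimes>\<^bsub>A\<^esub> gv v) \<otimes>\<^bsub>A\<^esub> inv\<^bsub>A\<^esub> gv r"
        by (simp add: A.inv_mult_group A.m_assoc)
      finally show ?thesis by (simp add: embed_arc[OF uv] com)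
    qed
  qed
  then show ?thesis by simp
qed


section \<open>The action on the dual Artin group and injectivity\<close>

text \<open>The map \<open>x \<mapsto> p v \<otimes> conj_root x\<close> after the one for
  \<open>w\<close> sends the identity to the left side, so this is commutation of the two actions at
  the identity. For a tree arc it follows from the value of \<open>conj_root\<close> on that arc.
  Otherwise both sides are the elements of two tree arcs from a common \<open>m\<close>, in either
  order, times the same factor; the triangle makes them commute.\<close>

lemma vertex_commute:
  assumes "(v, w) \<in> parcs \<Gamma>"
  shows "p v \<otimes>\<^bsub>P\<^esub> conj_root (p w) = p w \<otimes>\<^bsub>P\<^esub> conj_root (p v)"
proof -
  have image: "conj_root (p b) = inv\<^bsub>P\<^esub> p a \<otimes>\<^bsub>P\<^esub> p b \<otimes>\<^bsub>P\<^esub> conj_root (p a)" if "(a, b) \<in> parcs T" for a b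
    using that tree_arc_verts[OF that] by (simp add: p_arc[OF that] conj_root_arc)
  show ?thesis
  proof (rule tree_2_spanner_cases[OF spanner graph assms])
    assume vw: "(v, w) \<in> parcs T"
    then have "v \<in> pverts \<Gamma>" "w \<in> pverts \<Gamma>" using tree_arc_verts by auto
    then show ?thesis
      unfolding image[OF vw] by (simp add: P.m_assoc[symmetric])
  next
    fix m assume vm: "(v, m) \<in> parcs T" and mw: "(m, w) \<in> parcs T"
    have mv: "(m, v) \<in> parcs T" using vm by (rule T.arc_sym)
    have verts: "v \<in> pverts \<Gamma>" "w \<in> pverts \<Gamma>" "m \<in> pverts \<Gamma>"
      using mv mw tree_arc_verts by auto
    have pv: "p v = arc_elem (m, v) \<otimes>\<^bsub>P\<^esub> p m" and pw: "p w = arc_elem (m, w) \<otimes>\<^bsub>P\<^esub> p m"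
      using mv mw p_arc by auto
    have "p v \<otimes>\<^bsub>P\<^esub> conj_root (p w) = arc_elem (m, v) \<otimes>\<^bsub>P\<^esub> arc_elem (m, w) \<otimes>\<^bsub>P\<^esub> (p m \<otimes>\<^bsub>P\<^esub> conj_root (p m))"
      unfolding image[OF mw] using verts mv mw
      by (simp add: pv pw P.m_assoc P.cancel_inv_left)
    moreover have "p w \<otimes>\<^bsub>P\<^esub> conj_root (p v) = arc_elem (m, w) \<otimes>\<^bsub>P\<^esub> arc_elem (m, v) \<otimes>\<^bsub>P\<^esub> (p m \<otimes>\<^bsub>P\<^esub> conj_root (p m))"
      unfolding image[OF mv] using verts mv mw
      by (simp add: pv pw P.m_assoc P.cancel_inv_left)
    ultimately show ?thesis using arc_elem_commute[OF mv mw assms] by simp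
  qed
qed

text \<open>\<^term>\<open>A\<close> acts on the carrier of \<^term>\<open>P\<close> as on the cosets of the root generator: the vertex \<open>v\<close>
  acts by \<open>x \<mapsto> p v \<otimes> conj_root x\<close>. Since \<^term>\<open>embed x\<close> acts by left multiplication with \<open>x\<close>,
  \<^term>\<open>embed\<close> is injective.\<close>

definition vertex_act :: "'a \<times> bool \<Rightarrow> 'a set word set \<Rightarrow> 'a set word set" where
  "vertex_act l x =
     (if snd l then p (fst l) \<otimes>\<^bsub>P\<^esub> conj_root x else conj_root_inv (inv\<^bsub>P\<^esub> p (fst l) \<otimes>\<^bsub>P\<^esub> x))"

lemma vertex_act_closed:
  "w \<in> words (pverts \<Gamma>) \<Longrightarrow> x \<in> carrier P \<Longrightarrow> foldr vertex_act w x \<in> carrier P"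
  by (induction w) (auto simp: vertex_act_def)

lemma vertex_act_cancel:
  assumes "v \<in> pverts \<Gamma>" "x \<in> carrier P"
  shows "vertex_act (v, b) (vertex_act (v, \<not> b) x) = x"
  using assms
  by (cases b)
    (simp_all add: vertex_act_def conj_root_cancel conj_root_inv_cancel P.m_assoc[symmetric]
      del: \<psi>.hom_mult)

lemma vertex_act_commute:
  assumes "(v, w) \<in> parcs \<Gamma>" "x \<in> carrier P"
  shows "vertex_act (v, True) (vertex_act (w, True) x) = vertex_act (w, True) (vertex_act (v, True) x)"
proof -
  have "v \<in> pverts \<Gamma>" "w \<in> pverts \<Gamma>" using assms(1) \<Gamma>.wellformed' by auto
  then show ?thesis
    using assms(2) vertex_commute[OF assms(1)] by (simp add: vertex_act_def P.m_assoc[symmetric])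
qed

text \<open>A word acts by composition, last letter first. The action depends only on the class of
  the word, because inverse pairs and commutators of adjacent vertices act trivially.\<close>

lemma vertex_act_pres_eq:
  assumes "pres_eq (pverts \<Gamma>) (raag_relators \<Gamma>) w w'" "x \<in> carrier P"
  shows "foldr vertex_act w x = foldr vertex_act w' x"
  using assms
proof (induction arbitrary: x rule: pres_eq.induct)
  case (cancel u v s b)
  then show ?case by (simp add: vertex_act_cancel vertex_act_closed)
next
  case (relator u v rel)
  then obtain s t where st: "(s, t) \<in> parcs \<Gamma>" "rel = word_comm s t" by (auto simp: raag_relators_def)
  then have verts: "s \<in> pverts \<Gamma>" "t \<in> pverts \<Gamma>" using \<Gamma>.wellformed' by auto
  define y where "y = foldr vertex_act v x"
  have y: "y \<in> carrier P" using relator by (simp add: y_def vertex_act_closed)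
  \<comment> \<open>At \<open>z\<close> the two negative letters of the commutator have already
    acted, so swapping the positive ones lets everything cancel back to \<open>y\<close>.\<close>
  define z where "z = vertex_act (s, False) (vertex_act (t, False) y)"
  have z: "z \<in> carrier P"
    using y verts vertex_act_closed[of "[(s, False), (t, False)]" y] by (simp add: z_def)
  have "vertex_act (s, True) (vertex_act (t, True) z) = vertex_act (t, True) (vertex_act (s, True) z)"
    using st(1) z by (rule vertex_act_commute)
  also have "\<dots> = vertex_act (t, True) (vertex_act (t, False) y)"
    using vertex_act_cancel[of s "vertex_act (t, False) y" True] verts y
      vertex_act_closed[of "[(t, False)]" y] by (simp add: z_def)
  also have "\<dots> = y" using vertex_act_cancel[of t y True] verts y by simp
  finally show ?case by (simp add: st(2) word_comm_def z_def y_def)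
qed auto

lemma embed_act:
  assumes "x \<in> carrier P"
  shows "\<exists>w\<in>words (pverts \<Gamma>). embed x = pres_class (pverts \<Gamma>) (raag_relators \<Gamma>) w \<and>
    (\<forall>y\<in>carrier P. foldr vertex_act w y = x \<otimes>\<^bsub>P\<^esub> y)"
  using assms
proof (induction rule: presented_P_induct)
  case one
  show ?case
    by (rule bexI[of _ "[]"]) (simp_all add: raag_def[of \<Gamma>] presented_group_one[symmetric])
next
  case (arc u v x)
  then obtain w where w: "w \<in> words (pverts \<Gamma>)"
      "embed x = pres_class (pverts \<Gamma>) (raag_relators \<Gamma>) w"
      "\<And>y. y \<in> carrier P \<Longrightarrow> foldr vertex_act w y = x \<otimes>\<^bsub>P\<^esub> y"
    by blast
  note uv = tree_arc_verts[OF arc(1)]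
  \<comment> \<open>The new prefix represents \<open>v u^-1\<close>. In its action
    \<open>conj_root\<close> and \<open>conj_root_inv\<close> cancel, and
    \<open>p v \<otimes> inv (p u)\<close> remains, which is \<open>arc_elem (u, v)\<close>.\<close>
  let ?w = "(v, True) # (u, False) # w"
  have "embed x = word_eval A gv w"
    by (simp only: w(2) word_eval_pres_gen[OF w(1)] raag_def[of \<Gamma>] raag_gen_def[of \<Gamma>])
  moreover from this have "word_eval A gv w \<in> carrier A" using F.hom_closed[OF arc(2)] by simp
  ultimately have "embed (arc_elem (u, v) \<otimes>\<^bsub>P\<^esub> x) = word_eval A gv ?w"
    using arc(1,2) uv by (simp add: embed_arc A.m_assoc)
  then have "embed (arc_elem (u, v) \<otimes>\<^bsub>P\<^esub> x) = pres_class (pverts \<Gamma>) (raag_relators \<Gamma>) ?w"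
    using word_eval_pres_gen[of ?w "pverts \<Gamma>" "raag_relators \<Gamma>"] uv w(1)
    by (simp only: raag_def[of \<Gamma>] raag_gen_def[of \<Gamma>]) simp
  moreover have "foldr vertex_act ?w y = arc_elem (u, v) \<otimes>\<^bsub>P\<^esub> x \<otimes>\<^bsub>P\<^esub> y" if y: "y \<in> carrier P" for y
    using w(3)[OF y] uv arc(1,2) y arc_elem_p[OF arc(1)]
    by (simp add: vertex_act_def conj_root_cancel P.m_assoc del: \<psi>.hom_mult)
  ultimately show ?case using w(1) uv by (intro bexI[of _ ?w]) auto
qed

lemma embed_eq_one:
  assumes "x \<in> carrier P" "embed x = \<one>\<^bsub>A\<^esub>"
  shows "x = \<one>\<^bsub>P\<^esub>"
proof -
  obtain w where w: "w \<in> words (pverts \<Gamma>)" "embed x = pres_class (pverts \<Gamma>) (raag_relators \<Gamma>) w"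
      "\<And>y. y \<in> carrier P \<Longrightarrow> foldr vertex_act w y = x \<otimes>\<^bsub>P\<^esub> y"
    using embed_act[OF assms(1)] by blast
  have "pres_class (pverts \<Gamma>) (raag_relators \<Gamma>) w = pres_class (pverts \<Gamma>) (raag_relators \<Gamma>) []"
    using w(2) assms(2) by (simp add: raag_def[of \<Gamma>] presented_group_one)
  then have "pres_eq (pverts \<Gamma>) (raag_relators \<Gamma>) w []"
    by (simp only: pres_class_eq_iff[OF w(1)])
  \<comment> \<open>Acting on the identity, \<open>w\<close> returns \<open>x\<close>; being
    trivial, it also returns the identity.\<close>
  from vertex_act_pres_eq[OF this P.one_closed] w(3)[OF P.one_closed] assms(1) show ?thesis by simp
qed

section \<open>The image as the kernel of the height map\<close>

abbreviation height where "height \<equiv> induced_map integer_group (\<lambda>_. 1)"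

sublocale height: group_hom A integer_group height
  by (simp add: group_hom_def group_hom_axioms_def height_hom A.is_group group_integer_group)

lemma height_embed:
  assumes "x \<in> carrier P"
  shows "height (embed x) = 0"
proof -
  have "(height \<circ> embed) x = (\<lambda>_. 0) x"
  proof (rule tree_hom_eqI[OF group_integer_group _ _ _ assms])
    show "height \<circ> embed \<in> hom P integer_group"
      by (rule Group.hom_compose[OF embed_hom height_hom])
    show "(\<lambda>_. 0) \<in> hom P integer_group" by (simp add: hom_def)
    show "(height \<circ> embed) (arc_elem (u, v)) = 0" if "(u, v) \<in> parcs T" for u v
      using tree_arc_verts[OF that] by (simp add: embed_arc[OF that] height_gen)
  qed
  then show ?thesis by simp
qed

text \<open>The products \<open>embed x\<close> times a power of \<open>r\<close> are stable under
  left multiplication by vertices and their inverses: a vertex \<open>v\<close> is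
  \<open>embed (p v)\<close> times \<open>r\<close>, and \<open>r\<close> moves past
  \<open>embed x\<close> at the cost of applying \<open>conj_root\<close>.\<close>

lemma embed_decomposition:
  assumes "g \<in> carrier A"
  shows "\<exists>x\<in>carrier P. \<exists>k::int. g = embed x \<otimes>\<^bsub>A\<^esub> gv r [^]\<^bsub>A\<^esub> k"
proof -
  have vertex: "gv v = embed (p v) \<otimes>\<^bsub>A\<^esub> gv r" if "v \<in> pverts \<Gamma>" for v
    using that by (simp add: embed_p A.m_assoc)
  have "\<exists>y\<in>carrier P. \<exists>l::int. gv v \<otimes>\<^bsub>A\<^esub> (embed x \<otimes>\<^bsub>A\<^esub> gv r [^]\<^bsub>A\<^esub> k) = embed y \<otimes>\<^bsub>A\<^esub> gv r [^]\<^bsub>A\<^esub> l"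
    if "v \<in> pverts \<Gamma>" "x \<in> carrier P" for v x and k :: int
  proof (intro bexI exI)
    show "gv v \<otimes>\<^bsub>A\<^esub> (embed x \<otimes>\<^bsub>A\<^esub> gv r [^]\<^bsub>A\<^esub> k) =
        embed (p v \<otimes>\<^bsub>P\<^esub> conj_root x) \<otimes>\<^bsub>A\<^esub> gv r [^]\<^bsub>A\<^esub> (1 + k)"
      using that
      by (simp add: vertex[of v] embed_conj_root A.int_pow_mult A.m_assoc A.cancel_inv_left)
    show "p v \<otimes>\<^bsub>P\<^esub> conj_root x \<in> carrier P" using that by simp
  qed
  moreover have "\<exists>y\<in>carrier P. \<exists>l::int. inv\<^bsub>A\<^esub> gv v \<otimes>\<^bsub>A\<^esub> (embed x \<otimes>\<^bsub>A\<^esub> gv r [^]\<^bsub>A\<^esub> k) = embed y \<otimes>\<^bsub>A\<^esub> gv r [^]\<^bsub>A\<^esub> l"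
    if "v \<in> pverts \<Gamma>" "x \<in> carrier P" for v x and k :: int
  proof (intro bexI exI)
    let ?y = "inv\<^bsub>P\<^esub> p v \<otimes>\<^bsub>P\<^esub> x"
    have y: "?y \<in> carrier P" using that by simp
    have "inv\<^bsub>A\<^esub> gv v \<otimes>\<^bsub>A\<^esub> embed x = inv\<^bsub>A\<^esub> gv r \<otimes>\<^bsub>A\<^esub> embed ?y"
      using that by (simp add: vertex[of v] A.inv_mult_group A.m_assoc)
    \<comment> \<open>Written as a value of \<open>conj_root\<close>, the factor lets
      \<open>r^-1\<close> pass to its right.\<close>
    also have "\<dots> = inv\<^bsub>A\<^esub> gv r \<otimes>\<^bsub>A\<^esub> embed (conj_root (conj_root_inv ?y))"
      by (simp only: conj_root_cancel[OF y])
    also have "\<dots> = embed (conj_root_inv ?y) \<otimes>\<^bsub>A\<^esub> inv\<^bsub>A\<^esub> gv r"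
      using y by (simp add: embed_conj_root A.m_assoc[symmetric] del: \<psi>.hom_mult F.hom_mult)
    finally have "inv\<^bsub>A\<^esub> gv v \<otimes>\<^bsub>A\<^esub> embed x = embed (conj_root_inv ?y) \<otimes>\<^bsub>A\<^esub> inv\<^bsub>A\<^esub> gv r" .
    moreover have "gv r [^]\<^bsub>A\<^esub> (- 1 + k) = inv\<^bsub>A\<^esub> gv r \<otimes>\<^bsub>A\<^esub> gv r [^]\<^bsub>A\<^esub> k"
      by (simp only: A.int_pow_mult[OF gr_closed] A.int_pow_neg[OF gr_closed] A.int_pow_1[OF gr_closed])
    ultimately show "inv\<^bsub>A\<^esub> gv v \<otimes>\<^bsub>A\<^esub> (embed x \<otimes>\<^bsub>A\<^esub> gv r [^]\<^bsub>A\<^esub> k) =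
        embed (conj_root_inv ?y) \<otimes>\<^bsub>A\<^esub> gv r [^]\<^bsub>A\<^esub> (- 1 + k)"
      using that y by (simp add: A.m_assoc[symmetric] del: \<psi>.hom_mult F.hom_mult)
    show "conj_root_inv ?y \<in> carrier P" using y by (rule \<psi>.hom_closed)
  qed
  ultimately have step: "\<exists>y\<in>carrier P. \<exists>l::int. h \<otimes>\<^bsub>A\<^esub> g = embed y \<otimes>\<^bsub>A\<^esub> gv r [^]\<^bsub>A\<^esub> l"
    if "\<exists>x\<in>carrier P. \<exists>k::int. g = embed x \<otimes>\<^bsub>A\<^esub> gv r [^]\<^bsub>A\<^esub> k" "h = gv v \<or> h = inv\<^bsub>A\<^esub> gv v" "v \<in> pverts \<Gamma>"
    for g h v
    using that by blast
  show ?thesis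
    using assms[unfolded raag_def[of \<Gamma>]]
  proof (induction rule: presented_group_induct)
    case one
    have "\<one>\<^bsub>A\<^esub> = embed \<one>\<^bsub>P\<^esub> \<otimes>\<^bsub>A\<^esub> gv r [^]\<^bsub>A\<^esub> (0::int)" by simp
    then show ?case unfolding raag_def[of \<Gamma>, symmetric] by blast
  next
    case (gen v x)
    then show ?case using step[of x "gv v" v] by (simp add: raag_def[of \<Gamma>] raag_gen_def[of \<Gamma>])
  next
    case (inv v x)
    then show ?case using step[of x "inv\<^bsub>A\<^esub> gv v" v] by (simp add: raag_def[of \<Gamma>] raag_gen_def[of \<Gamma>])
  qed
qed

lemma embed_image: "embed ` carrier P = carrier (bb_group \<Gamma>)"
proof
  have kernel: "carrier (bb_group \<Gamma>) = {g \<in> carrier A. height g = 0}"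
    by (simp add: bb_group_def kernel_def)
  then show "embed ` carrier P \<subseteq> carrier (bb_group \<Gamma>)"
    using height_embed F.hom_closed by auto
  show "carrier (bb_group \<Gamma>) \<subseteq> embed ` carrier P"
  proof
    fix g assume "g \<in> carrier (bb_group \<Gamma>)"
    then have g: "g \<in> carrier A" "height g = 0" by (simp_all add: kernel)
    then obtain x and k :: int where x: "x \<in> carrier P" "g = embed x \<otimes>\<^bsub>A\<^esub> gv r [^]\<^bsub>A\<^esub> k"
      using embed_decomposition by blast
    \<comment> \<open>Image elements have height 0, so the height of the product reads off the
      exponent, which must vanish in the kernel.\<close>
    have "height (gv r [^]\<^bsub>A\<^esub> k) = k"
      using height.hom_int_pow[OF gr_closed, of k] root by (simp add: height_gen)
    then have "k = 0" using g x by (simp add: height_embed)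
    then show "g \<in> embed ` carrier P" using x by simp
  qed
qed

text \<open>The image of \<open>embed\<close> gives generation of the subgroup, and its injectivity
  gives completeness of the relators.\<close>

lemma realizes_dual:
  "realizes A (carrier (bb_group \<Gamma>)) (uedges T) (raag_relators dual) (\<lambda>e. edge_elem \<Gamma> (ori e))"
proof -
  have carrier_P: "carrier P = pres_class (uedges T) (raag_relators dual) ` words (uedges T)"
    by (simp add: raag_def dual_verts presented_group_carrier)
  have closed: "edge_elem \<Gamma> (ori e) \<in> carrier A" if "e \<in> uedges T" for e
    using that by (elim ori_arc) (simp add: edge_elem_def tree_arc_verts)
  have image: "word_eval A (\<lambda>e. edge_elem \<Gamma> (ori e)) ` words (uedges T) = carrier (bb_group \<Gamma>)"
    unfolding embed_image[symmetric] carrier_P image_image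
    by (intro image_cong HOL.refl embed_class[symmetric])
  have "word_eval A (\<lambda>e. edge_elem \<Gamma> (ori e)) w = \<one>\<^bsub>A\<^esub> \<longleftrightarrow>
      pres_eq (uedges T) (raag_relators dual) w []" if "w \<in> words (uedges T)" for w
  proof -
    have one_P: "\<one>\<^bsub>P\<^esub> = pres_class (uedges T) (raag_relators dual) []"
      by (simp add: raag_def dual_verts presented_group_one)
    have "pres_class (uedges T) (raag_relators dual) w \<in> carrier P"
      using that by (simp add: carrier_P)
    then have "embed (pres_class (uedges T) (raag_relators dual) w) = \<one>\<^bsub>A\<^esub> \<longleftrightarrow>
        pres_class (uedges T) (raag_relators dual) w = \<one>\<^bsub>P\<^esub>"
      using embed_eq_one F.hom_one by metis
    then show ?thesis using that by (simp add: embed_class one_P pres_class_eq_iff)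
  qed
  with closed image show ?thesis by (simp add: realizes_def)
qed

end

section \<open>The Dicks--Leary presentation\<close>

lemma (in group) word_eval_replicate:
  assumes "f s \<in> carrier G"
  shows "word_eval G f (replicate k (s, b)) = (if b then f s else inv f s) [^] k"
  using assms by (induction k) (simp_all add: nat_pow_Suc2[symmetric] del: nat_pow_Suc)

lemma (in group) word_eval_letter_power:
  assumes "f s \<in> carrier G"
  shows "word_eval G f (letter_power s n) = f s [^] n"
proof (cases "n > 0")
  case True
  then have "f s [^] n = f s [^] nat n" using int_pow_int[of G "f s" "nat n"] by simp
  then show ?thesis using True assms by (simp add: letter_power_def word_eval_replicate)
next
  case False
  \<comment> \<open>This case includes \<open>n = 0\<close>, where the word is empty whatever its
    sign bit.\<close>
  define k where "k = nat (- n)"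
  have n: "n = - int k" using False by (simp add: k_def)
  show ?thesis
    using assms by (simp add: n letter_power_def word_eval_replicate nat_pow_inv int_pow_neg_int)
qed

lemma letter_power_in_words: "s \<in> S \<Longrightarrow> letter_power s n \<in> words S"
  by (auto simp: letter_power_def words_def)

lemma concat_in_words: "(\<And>w. w \<in> set ws \<Longrightarrow> w \<in> words S) \<Longrightarrow> concat ws \<in> words S"
  by (induction ws) auto

context pair_graph
begin

lemma edge_elem_closed: "e \<in> parcs G \<Longrightarrow> edge_elem G e \<in> carrier (raag G)"
proof -
  interpret R: group "raag G" by (rule raag_is_group)
  show "e \<in> parcs G \<Longrightarrow> edge_elem G e \<in> carrier (raag G)"
    by (simp add: edge_elem_def raag_gen_closed arc_fst_in_verts arc_snd_in_verts)
qed

lemma dicks_leary_relators_in_words: "dicks_leary_relators G \<subseteq> words (parcs G)"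
proof
  fix w assume "w \<in> dicks_leary_relators G"
  then obtain p n where "cycle p" and w: "w = concat (map (\<lambda>e. letter_power e n) p)"
    by (auto simp: dicks_leary_relators_def)
  then have "set p \<subseteq> parcs G" by (auto simp: cycle_def awalk_def)
  then show "w \<in> words (parcs G)"
    unfolding w by (intro concat_in_words) (auto intro: letter_power_in_words)
qed

text \<open>Since the end points of an arc commute, the powers along a walk telescope.\<close>

lemma word_eval_edge_elem_walk:
  assumes "awalk u p v"
  shows "word_eval (raag G) (edge_elem G) (concat (map (\<lambda>e. letter_power e n) p)) =
    inv\<^bsub>raag G\<^esub> (raag_gen G u [^]\<^bsub>raag G\<^esub> n) \<otimes>\<^bsub>raag G\<^esub> (raag_gen G v [^]\<^bsub>raag G\<^esub> n)"
  using assms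
proof (induction p arbitrary: u)
  case Nil
  interpret R: group "raag G" by (rule raag_is_group)
  have "u = v" "raag_gen G v \<in> carrier (raag G)"
    using Nil by (auto simp: awalk_Nil_iff intro: raag_gen_closed)
  then show ?case by simp
next
  case (Cons e p)
  interpret R: group "raag G" by (rule raag_is_group)
  obtain w where e: "e = (u, w)" "(u, w) \<in> parcs G" and p: "awalk w p v"
    using Cons.prems by (cases e) (auto simp: awalk_Cons_iff)
  have [simp]: "raag_gen G u \<in> carrier (raag G)" "raag_gen G w \<in> carrier (raag G)"
      "raag_gen G v \<in> carrier (raag G)"
    using e(2) awalk_last_in_verts[OF p] wellformed' by (auto intro!: raag_gen_closed)
  have com: "inv\<^bsub>raag G\<^esub> raag_gen G u \<otimes>\<^bsub>raag G\<^esub> raag_gen G w =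
      raag_gen G w \<otimes>\<^bsub>raag G\<^esub> inv\<^bsub>raag G\<^esub> raag_gen G u"
    by (rule R.commute_inv[OF raag_gen_commute[OF e(2)]]) simp_all
  have "edge_elem G e [^]\<^bsub>raag G\<^esub> n =
      (inv\<^bsub>raag G\<^esub> raag_gen G u \<otimes>\<^bsub>raag G\<^esub> raag_gen G w) [^]\<^bsub>raag G\<^esub> n"
    by (simp add: e edge_elem_def com)
  also have "\<dots> = inv\<^bsub>raag G\<^esub> (raag_gen G u [^]\<^bsub>raag G\<^esub> n) \<otimes>\<^bsub>raag G\<^esub> raag_gen G w [^]\<^bsub>raag G\<^esub> n"
    by (simp add: R.int_pow_mult_distrib[OF com] R.int_pow_inv)
  finally have power: "edge_elem G e [^]\<^bsub>raag G\<^esub> n =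
      inv\<^bsub>raag G\<^esub> (raag_gen G u [^]\<^bsub>raag G\<^esub> n) \<otimes>\<^bsub>raag G\<^esub> raag_gen G w [^]\<^bsub>raag G\<^esub> n" .
  have sub: "e \<in> parcs G" "set p \<subseteq> parcs G" using e p by (auto simp: awalk_def)
  then have "word_eval (raag G) (edge_elem G) (concat (map (\<lambda>e. letter_power e n) (e # p))) =
      edge_elem G e [^]\<^bsub>raag G\<^esub> n \<otimes>\<^bsub>raag G\<^esub>
      word_eval (raag G) (edge_elem G) (concat (map (\<lambda>e. letter_power e n) p))"
    using edge_elem_closed
    by (subst R.word_eval_letter_power[symmetric], simp,
        subst R.word_eval_append[of _ "parcs G", symmetric])
      (auto intro!: concat_in_words letter_power_in_words)
  then show ?case
    by (simp add: Cons.IH[OF p] power R.m_assoc R.cancel_inv_left)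
qed

lemma word_eval_dicks_leary:
  assumes "w \<in> dicks_leary_relators G"
  shows "word_eval (raag G) (edge_elem G) w = \<one>\<^bsub>raag G\<^esub>"
proof -
  interpret R: group "raag G" by (rule raag_is_group)
  obtain p n u where "w = concat (map (\<lambda>e. letter_power e n) p)" "awalk u p u"
    using assms by (auto simp: dicks_leary_relators_def cycle_def)
  then show ?thesis
    using awalk_last_in_verts[of u p u] by (simp add: word_eval_edge_elem_walk raag_gen_closed)
qed

abbreviation DL where "DL \<equiv> presented_group (parcs G) (dicks_leary_relators G)"
abbreviation dl where "dl \<equiv> pres_gen (parcs G) (dicks_leary_relators G)"

lemma dl_closed: "e \<in> parcs G \<Longrightarrow> dl e \<in> carrier DL"
  by (rule pres_gen_closed)

lemma cycle_relator:
  assumes "cycle p" "n \<noteq> 0"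
  shows "word_eval DL dl (concat (map (\<lambda>e. letter_power e n) p)) = \<one>\<^bsub>DL\<^esub>"
proof -
  let ?w = "concat (map (\<lambda>e. letter_power e n) p)"
  have w: "?w \<in> dicks_leary_relators G" using assms by (auto simp: dicks_leary_relators_def)
  then have words: "?w \<in> words (parcs G)" using dicks_leary_relators_in_words by blast
  then have "pres_eq (parcs G) (dicks_leary_relators G) ?w []"
    using pres_eq.relator[of "[]" _ "[]" ?w] w by simp
  then show ?thesis using pres_eq_Nil_iff[OF words] by simp
qed

text \<open>An edge and its reverse form a cycle of length 2; its relator with exponent 1 makes the
  product trivial.\<close>

lemma dl_inv:
  assumes "(u, v) \<in> parcs G"
  shows "dl (v, u) = inv\<^bsub>DL\<^esub> dl (u, v)"
proof -
  interpret DL: group DL by (rule presented_group_is_group)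
  have uv: "u \<noteq> v" "(v, u) \<in> parcs G" "u \<in> pverts G"
    using pair_no_loops[OF assms] arc_sym[OF assms] in_arcsD1[OF assms] by auto
  then have "cycle [(u, v), (v, u)]"
    using assms unfolding cycle_def by (intro exI[of _ u]) (simp add: awalk_def)
  from cycle_relator[OF this, of 1] have "dl (u, v) \<otimes>\<^bsub>DL\<^esub> dl (v, u) = \<one>\<^bsub>DL\<^esub>"
    using dl_closed uv(2) assms by (simp add: letter_power_def)
  then show ?thesis
    using dl_closed uv(2) assms DL.inv_equality[of "dl (v, u)" "dl (u, v)"]
      DL.inv_comm[of "dl (u, v)" "dl (v, u)"] by auto
qed

text \<open>The relators of a triangle with exponents \<open>1\<close> and \<open>-1\<close> give the two orders of the product.\<close>

lemma dl_triangle: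
  assumes "(a, b) \<in> parcs G" "(b, c) \<in> parcs G" "(c, a) \<in> parcs G"
  shows "dl (a, c) = dl (a, b) \<otimes>\<^bsub>DL\<^esub> dl (b, c)"
    and "dl (a, b) \<otimes>\<^bsub>DL\<^esub> dl (b, c) = dl (b, c) \<otimes>\<^bsub>DL\<^esub> dl (a, b)"
proof -
  interpret DL: group DL by (rule presented_group_is_group)
  have neq: "a \<noteq> b" "b \<noteq> c" "c \<noteq> a" using assms[THEN pair_no_loops] by auto
  have cyc: "cycle [(a, b), (b, c), (c, a)]"
    using assms neq in_arcsD1[OF assms(1)] unfolding cycle_def
    by (intro exI[of _ a]) (auto simp: awalk_def)
  note [simp] = dl_closed[OF assms(1)] dl_closed[OF assms(2)] dl_closed[OF assms(3)]
  have 1: "dl (a, b) \<otimes>\<^bsub>DL\<^esub> dl (b, c) \<otimes>\<^bsub>DL\<^esub> dl (c, a) = \<one>\<^bsub>DL\<^esub>"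
    using cycle_relator[OF cyc, of 1] by (simp add: letter_power_def DL.m_assoc)
  have 2: "inv\<^bsub>DL\<^esub> dl (a, b) \<otimes>\<^bsub>DL\<^esub> inv\<^bsub>DL\<^esub> dl (b, c) \<otimes>\<^bsub>DL\<^esub> inv\<^bsub>DL\<^esub> dl (c, a) = \<one>\<^bsub>DL\<^esub>"
    using cycle_relator[OF cyc, of "-1"] by (simp add: letter_power_def DL.m_assoc)
  show ac: "dl (a, c) = dl (a, b) \<otimes>\<^bsub>DL\<^esub> dl (b, c)"
    using DL.inv_equality[OF 1] dl_inv[OF assms(3)] by simp
  \<comment> \<open>Inverting a product reverses it, so the relator with exponent \<open>-1\<close>
    compares \<open>dl (a, c)\<close> with the product in the opposite order.\<close>
  have "inv\<^bsub>DL\<^esub> (dl (b, c) \<otimes>\<^bsub>DL\<^esub> dl (a, b)) \<otimes>\<^bsub>DL\<^esub> dl (a, c) = \<one>\<^bsub>DL\<^esub>"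
    using 2 dl_inv[OF assms(3)] by (simp add: DL.inv_mult_group)
  from DL.inv_equality[OF this]
  have "inv\<^bsub>DL\<^esub> dl (a, c) = inv\<^bsub>DL\<^esub> (dl (b, c) \<otimes>\<^bsub>DL\<^esub> dl (a, b))" by (simp add: ac)
  then have "inv\<^bsub>DL\<^esub> (inv\<^bsub>DL\<^esub> dl (a, c)) =
      inv\<^bsub>DL\<^esub> (inv\<^bsub>DL\<^esub> (dl (b, c) \<otimes>\<^bsub>DL\<^esub> dl (a, b)))" by (simp only:)
  then have "dl (a, c) = dl (b, c) \<otimes>\<^bsub>DL\<^esub> dl (a, b)" by (simp add: ac)
  then show "dl (a, b) \<otimes>\<^bsub>DL\<^esub> dl (b, c) = dl (b, c) \<otimes>\<^bsub>DL\<^esub> dl (a, b)" using ac by simp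
qed

end

lemma subgroup_bb_group: "subgroup (carrier (bb_group G)) (raag G)"
proof -
  interpret group_hom "raag G" integer_group "induced_map integer_group (\<lambda>_. 1)"
    by (simp add: group_hom_def group_hom_axioms_def height_hom raag_is_group)
  show ?thesis using subgroup_kernel by (simp add: bb_group_def)
qed

lemma bb_group_eq: "bb_group G = (raag G)\<lparr>carrier := carrier (bb_group G)\<rparr>"
  by (simp add: bb_group_def)

lemma bb_group_realizes_imp_presents:
  assumes "realizes (raag G) (carrier (bb_group G)) S R f"
  shows "presents (bb_group G) S R f"
  by (subst bb_group_eq) (rule group.realizes_imp_presents[OF raag_is_group subgroup_bb_group assms])

section \<open>Comparison with the presentation on tree edges\<close>

context oriented_spanner
begin

lemma realizes_dual_graph:
  assumes "pverts \<Gamma> \<noteq> {}"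
  shows "realizes A (carrier (bb_group \<Gamma>)) (uedges T) (raag_relators dual) (\<lambda>e. edge_elem \<Gamma> (ori e))"
proof -
  obtain r where r: "r \<in> pverts \<Gamma>" using assms by blast
  then have rT: "r \<in> pverts T" by (simp add: tree_verts)
  note tree = T.pair_graph_axioms tree_connected tree_acyclic
  have d: "arc_elem \<in> parcs T \<rightarrow> carrier P" "(\<lambda>e. inv\<^bsub>P\<^esub> arc_elem e) \<in> parcs T \<rightarrow> carrier P"
    by auto
  have inv: "inv\<^bsub>P\<^esub> arc_elem (v, u) = inv\<^bsub>P\<^esub> (inv\<^bsub>P\<^esub> arc_elem (u, v))" if "(u, v) \<in> parcs T" for u v
    by (simp only: arc_elem_inv[OF that])
  obtain p where p: "p r = \<one>\<^bsub>P\<^esub>" "p \<in> pverts T \<rightarrow> carrier P"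
      "\<And>u v. (u, v) \<in> parcs T \<Longrightarrow> p v = arc_elem (u, v) \<otimes>\<^bsub>P\<^esub> p u"
    by (rule P.tree_potential[OF tree d(1) arc_elem_inv rT]) (assumption, rule that)
  \<comment> \<open>A right-handed potential is the pointwise inverse of a left-handed one for the
    inverted arc elements.\<close>
  obtain q where q: "q r = \<one>\<^bsub>P\<^esub>" "q \<in> pverts T \<rightarrow> carrier P"
      "\<And>u v. (u, v) \<in> parcs T \<Longrightarrow> q v = inv\<^bsub>P\<^esub> arc_elem (u, v) \<otimes>\<^bsub>P\<^esub> q u"
    by (rule P.tree_potential[OF tree d(2) inv rT]) (assumption, rule that)
  interpret spanner_potential \<Gamma> T ori r p "\<lambda>v. inv\<^bsub>P\<^esub> q v"
  proof
    show "inv\<^bsub>P\<^esub> q v = inv\<^bsub>P\<^esub> q u \<otimes>\<^bsub>P\<^esub> arc_elem (u, v)" if "(u, v) \<in> parcs T" for u v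
    proof -
      have "q u \<in> carrier P" using q(2) that T.wellformed' by auto
      then show ?thesis using that by (simp add: q(3) P.inv_mult_group)
    qed
    show "p v = arc_elem (u, v) \<otimes>\<^bsub>P\<^esub> p u" if "(u, v) \<in> parcs T" for u v
      using that by (rule p(3))
  qed (use r p(1,2) q(1,2) tree_verts in auto)
  show ?thesis by (rule realizes_dual)
qed

lemma raag_relators_dual:
  "raag_relators dual = {word_comm e f | e f.
     e \<in> uedges T \<and> f \<in> uedges T \<and> e \<noteq> f \<and> in_common_triangle \<Gamma> e f}"
  by (auto simp: raag_relators_def dual_graph_def)

lemma raag_relators_in_words: "raag_relators dual \<subseteq> words (uedges T)"
  by (auto simp: raag_relators_dual word_comm_def)

text \<open>The dual relators with each edge renamed to its oriented arc, so that they live on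
  Dicks--Leary generators.\<close>

definition tree_relators :: "('v \<times> 'v) word set" where
  "tree_relators = {word_comm (ori e) (ori f) | e f.
     e \<in> uedges T \<and> f \<in> uedges T \<and> e \<noteq> f \<and> in_common_triangle \<Gamma> e f}"

lemma tree_relators_eq: "tree_relators = word_map ori ` raag_relators dual"
proof (intro equalityI subsetI)
  fix c assume "c \<in> tree_relators"
  then obtain e f where "c = word_comm (ori e) (ori f)" "word_comm e f \<in> raag_relators dual"
    unfolding tree_relators_def raag_relators_dual by blast
  then show "c \<in> word_map ori ` raag_relators dual"
    by (intro image_eqI[of _ _ "word_comm e f"]) simp_all
next
  fix c assume "c \<in> word_map ori ` raag_relators dual"
  then obtain e f where "c = word_map ori (word_comm e f)" "e \<in> uedges T" "f \<in> uedges T"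
      "e \<noteq> f" "in_common_triangle \<Gamma> e f"
    unfolding raag_relators_dual by blast
  then show "c \<in> tree_relators" unfolding tree_relators_def by auto
qed

lemma ori_in_arcs: "ori ` uedges T \<subseteq> parcs \<Gamma>"
proof
  fix a assume "a \<in> ori ` uedges T"
  then obtain e where "e \<in> uedges T" "a = ori e" by blast
  then show "a \<in> parcs \<Gamma>" using tree_arcs by (elim ori_arc) auto
qed

lemma tree_relators_in_words: "tree_relators \<subseteq> words (ori ` uedges T)"
  by (auto simp: tree_relators_def word_comm_def)

lemma realizes_tree:
  assumes "pverts \<Gamma> \<noteq> {}"
  shows "realizes A (carrier (bb_group \<Gamma>)) (ori ` uedges T) tree_relators (edge_elem \<Gamma>)"
  unfolding tree_relators_eq
  by (rule A.realizes_rename[where g = ori and f = "edge_elem \<Gamma>", OF realizes_dual_graph[OF assms] raag_relators_in_words])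

sublocale DL: group \<Gamma>.DL by (rule presented_group_is_group)

lemma dl_ori:
  assumes "(u, v) \<in> parcs T"
  shows "\<Gamma>.dl (ori {u, v}) = \<Gamma>.dl (u, v) \<or> \<Gamma>.dl (ori {u, v}) = inv\<^bsub>\<Gamma>.DL\<^esub> \<Gamma>.dl (u, v)"
  using ori_cases[OF assms]
proof
  assume "ori {u, v} = (v, u)"
  then show ?thesis by (simp only: \<Gamma>.dl_inv[OF subsetD[OF tree_arcs assms]] simp_thms)
qed simp

lemma tree_relators_dicks_leary:
  assumes "c \<in> tree_relators"
  shows "pres_eq (parcs \<Gamma>) (dicks_leary_relators \<Gamma>) c []"
proof -
  obtain e f where ef: "c = word_comm (ori e) (ori f)" "e \<in> uedges T" "f \<in> uedges T" "e \<noteq> f"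
      "in_common_triangle \<Gamma> e f"
    using assms by (auto simp: tree_relators_def)
  obtain m a b where mab: "(m, a) \<in> parcs T" "(m, b) \<in> parcs T" "(a, b) \<in> parcs \<Gamma>"
      "e = {m, a}" "f = {m, b}"
    using ef(2-5) by (rule common_triangleE)
  \<comment> \<open>\<open>dl_triangle\<close> concerns consecutive arcs, so the first arc is
    reversed to run into \<open>m\<close>.\<close>
  have am: "(a, m) \<in> parcs T" "e = {a, m}" using mab(4) T.arc_sym[OF mab(1)] by auto
  have arcs: "(a, m) \<in> parcs \<Gamma>" "(m, b) \<in> parcs \<Gamma>" "(b, a) \<in> parcs \<Gamma>"
    using am(1) mab(2) tree_arcs \<Gamma>.arc_sym[OF mab(3)] by auto
  have "\<Gamma>.dl (ori e) \<otimes>\<^bsub>\<Gamma>.DL\<^esub> \<Gamma>.dl (ori f) = \<Gamma>.dl (ori f) \<otimes>\<^bsub>\<Gamma>.DL\<^esub> \<Gamma>.dl (ori e)"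
    unfolding am(2) mab(5)
    by (rule DL.commute_signed[OF \<Gamma>.dl_triangle(2)[OF arcs] \<Gamma>.dl_closed[OF arcs(1)]
          \<Gamma>.dl_closed[OF arcs(2)] dl_ori[OF am(1)] dl_ori[OF mab(2)]])
  moreover have ori: "ori e \<in> parcs \<Gamma>" "ori f \<in> parcs \<Gamma>" using ef(2,3) ori_in_arcs by auto
  ultimately have "word_eval \<Gamma>.DL \<Gamma>.dl c = \<one>\<^bsub>\<Gamma>.DL\<^esub>"
    unfolding ef(1) by (simp add: DL.word_eval_comm_eq_one_iff \<Gamma>.dl_closed)
  moreover have "c \<in> words (parcs \<Gamma>)" using ori by (simp add: ef(1) word_comm_def)
  ultimately show ?thesis by (simp add: pres_eq_Nil_iff)
qed

text \<open>A tree arc is a chosen generator or its inverse. An arc outside the tree closes a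
  triangle with two tree arcs, whose product it is by \<open>dl_triangle\<close>.\<close>

lemma dicks_leary_arc_word:
  assumes uv: "(u, v) \<in> parcs \<Gamma>"
  shows "\<exists>w\<in>words (ori ` uedges T). pres_eq (parcs \<Gamma>) (dicks_leary_relators \<Gamma>) [((u, v), True)] w"
proof -
  have sub: "words (ori ` uedges T) \<subseteq> words (parcs \<Gamma>)"
    using ori_in_arcs by (auto simp: words_def)
  have tree: "\<exists>w\<in>words (ori ` uedges T). \<Gamma>.dl (a, b) = word_eval \<Gamma>.DL \<Gamma>.dl w"
    if ab: "(a, b) \<in> parcs T" for a b
  proof -
    have ori: "ori {a, b} \<in> ori ` uedges T" using uedge[OF ab] by simp
    have closed: "\<Gamma>.dl (a, b) \<in> carrier \<Gamma>.DL" using ab tree_arcs by (intro \<Gamma>.dl_closed) auto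
    from dl_ori[OF ab] show ?thesis
    proof
      assume "\<Gamma>.dl (ori {a, b}) = \<Gamma>.dl (a, b)"
      then show ?thesis using ori closed by (intro bexI[of _ "[(ori {a, b}, True)]"]) simp_all
    next
      assume "\<Gamma>.dl (ori {a, b}) = inv\<^bsub>\<Gamma>.DL\<^esub> \<Gamma>.dl (a, b)"
      then show ?thesis using ori closed by (intro bexI[of _ "[(ori {a, b}, False)]"]) simp_all
    qed
  qed
  have "\<exists>w\<in>words (ori ` uedges T). \<Gamma>.dl (u, v) = word_eval \<Gamma>.DL \<Gamma>.dl w"
  proof (rule tree_2_spanner_cases[OF spanner graph uv])
    fix m assume m: "(u, m) \<in> parcs T" "(m, v) \<in> parcs T"
    obtain w w' where w: "w \<in> words (ori ` uedges T)" "\<Gamma>.dl (u, m) = word_eval \<Gamma>.DL \<Gamma>.dl w"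
      and w': "w' \<in> words (ori ` uedges T)" "\<Gamma>.dl (m, v) = word_eval \<Gamma>.DL \<Gamma>.dl w'"
      using tree[OF m(1)] tree[OF m(2)] by blast
    have "\<Gamma>.dl (u, v) = \<Gamma>.dl (u, m) \<otimes>\<^bsub>\<Gamma>.DL\<^esub> \<Gamma>.dl (m, v)"
      using m tree_arcs \<Gamma>.arc_sym[OF uv] by (intro \<Gamma>.dl_triangle(1)) auto
    also have "\<dots> = word_eval \<Gamma>.DL \<Gamma>.dl (w @ w')"
      using w w' sub \<Gamma>.dl_closed by (subst DL.word_eval_append[of _ "parcs \<Gamma>"]) auto
    finally show ?thesis using w(1) w'(1) by (intro bexI[of _ "w @ w'"]) simp_all
  qed (rule tree)
  then obtain w where w: "w \<in> words (ori ` uedges T)" "\<Gamma>.dl (u, v) = word_eval \<Gamma>.DL \<Gamma>.dl w"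
    by blast
  then have "w \<in> words (parcs \<Gamma>)" using sub by blast
  then have "pres_class (parcs \<Gamma>) (dicks_leary_relators \<Gamma>) [((u, v), True)] =
      pres_class (parcs \<Gamma>) (dicks_leary_relators \<Gamma>) w"
    using w(2) by (simp add: word_eval_pres_gen pres_gen_def[symmetric])
  then have "pres_eq (parcs \<Gamma>) (dicks_leary_relators \<Gamma>) [((u, v), True)] w"
    using uv by (subst pres_class_eq_iff[symmetric]) simp_all
  then show ?thesis using w(1) by blast
qed

lemma realizes_dicks_leary:
  assumes "pverts \<Gamma> \<noteq> {}"
  shows "realizes A (carrier (bb_group \<Gamma>)) (parcs \<Gamma>) (dicks_leary_relators \<Gamma>) (edge_elem \<Gamma>)"
proof (rule A.realizes_extend[OF realizes_tree[OF assms] ori_in_arcs tree_relators_in_words])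
  show "edge_elem \<Gamma> \<in> parcs \<Gamma> \<rightarrow> carrier A" using \<Gamma>.edge_elem_closed by blast
  show "\<exists>w\<in>words (ori ` uedges T). pres_eq (parcs \<Gamma>) (dicks_leary_relators \<Gamma>) [(s, True)] w"
    if "s \<in> parcs \<Gamma>" for s
    using dicks_leary_arc_word[of "fst s" "snd s"] that by simp
qed (simp_all add: \<Gamma>.word_eval_dicks_leary tree_relators_dicks_leary)

lemma spanner_simplifies:
  assumes "pverts \<Gamma> \<noteq> {}"
  shows "pres_simplifies (parcs \<Gamma>, dicks_leary_relators \<Gamma>)
    (ori ` uedges T,
     {word_comm (ori e) (ori f) | e f.
        e \<in> uedges T \<and> f \<in> uedges T \<and> e \<noteq> f \<and> in_common_triangle \<Gamma> e f})"
  unfolding tree_relators_def[symmetric]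
proof (rule A.realizes_imp_simplifies[OF realizes_tree[OF assms] ori_in_arcs tree_relators_in_words _
      realizes_dicks_leary[OF assms] \<Gamma>.dicks_leary_relators_in_words])
  show "finite (parcs \<Gamma> - ori ` uedges T)" using \<Gamma>.pair_finite_arcs by simp
  show "\<exists>w\<in>words (ori ` uedges T). pres_eq (parcs \<Gamma>) (dicks_leary_relators \<Gamma>) [(s, True)] w"
    if "s \<in> parcs \<Gamma>" for s
    using dicks_leary_arc_word[of "fst s" "snd s"] that by simp
qed

lemma spanner_presents:
  assumes "pverts \<Gamma> \<noteq> {}"
  shows "presents (bb_group \<Gamma>) (uedges T)
    {word_comm e f | e f.
       e \<in> uedges T \<and> f \<in> uedges T \<and> e \<noteq> f \<and> in_common_triangle \<Gamma> e f}
    (\<lambda>e. edge_elem \<Gamma> (ori e))"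
  using bb_group_realizes_imp_presents[OF realizes_dual_graph[OF assms]]
  by (simp only: raag_relators_dual)

end

section \<open>Natural numbers as vertices, and the conclusion\<close>

lemma (in group) realizes_imp_iso_raag:
  assumes "subgroup K G" "realizes G K (pverts D) (raag_relators D) f"
  shows "G\<lparr>carrier := K\<rparr> \<cong> raag D"
  using presents_imp_iso[OF realizes_imp_presents[OF assms]] raag_is_group[of D]
  by (simp add: raag_def group.iso_sym)

lemma raag_relators_eq_image: "raag_relators D = (\<lambda>(v, w). word_comm v w) ` parcs D"
  unfolding raag_relators_def by fast

text \<open>A numbering of the finite vertex set carries \<open>D\<close> to the vertex type fixed
  in \<open>is_raag\<close>, and the presentation is renamed along it.\<close>

lemma (in group) realizes_imp_is_raag:
  assumes K: "subgroup K G" and D: "pair_graph D"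
    and real: "realizes G K (pverts D) (raag_relators D) f"
  shows "is_raag (G\<lparr>carrier := K\<rparr>)"
proof -
  interpret D: pair_graph D by fact
  obtain g :: "_ \<Rightarrow> nat" where g: "inj_on g (pverts D)"
    using finite_imp_inj_to_nat_seg[OF D.pair_finite_verts] by blast
  define D' where "D' = \<lparr>pverts = g ` pverts D, parcs = map_prod g g ` parcs D\<rparr>"
  have "pair_graph D'"
  proof
    fix e assume "e \<in> parcs D'"
    then obtain u v where uv: "(u, v) \<in> parcs D" "e = (g u, g v)" by (auto simp: D'_def)
    then have verts: "u \<in> pverts D" "v \<in> pverts D" using D.wellformed' by auto
    then show "fst e \<in> pverts D'" "snd e \<in> pverts D'" using uv(2) by (simp_all add: D'_def)
    show "fst e \<noteq> snd e"
      using D.pair_no_loops[OF uv(1)] inj_onD[OF g _ verts] uv(2) by auto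
  next
    have "(g v, g u) \<in> map_prod g g ` parcs D" if "(u, v) \<in> parcs D" for u v
      using D.arc_sym[OF that] by (rule rev_image_eqI) simp
    then show "symmetric (with_proj D')" by (auto simp: D'_def symmetric_def sym_def)
    show "finite (pverts D')" "finite (parcs D')"
      using D.pair_finite_verts D.pair_finite_arcs by (simp_all add: D'_def)
  qed
  moreover have "realizes G K (pverts D') (raag_relators D') (\<lambda>n. f (inv_into (pverts D) g n))"
  proof -
    have "realizes G K (pverts D) (raag_relators D) (\<lambda>v. f (inv_into (pverts D) g (g v)))"
      using realizes_cong[OF real] g by simp
    moreover have "raag_relators D \<subseteq> words (pverts D)"
      using D.wellformed' by (auto simp: raag_relators_eq_image word_comm_def)
    moreover have "raag_relators D' = word_map g ` raag_relators D"
      unfolding raag_relators_eq_image image_image D'_def by (simp add: image_image case_prod_unfold)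
    ultimately show ?thesis
      using realizes_rename[where g = g and f = "\<lambda>n. f (inv_into (pverts D) g n)"] by (simp add: D'_def)
  qed
  ultimately show ?thesis
    unfolding is_raag_def using realizes_imp_iso_raag[OF K] by blast
qed

theorem theoremB:
  fixes \<Gamma> T :: "'v pair_pre_digraph"
  assumes "pair_graph \<Gamma>"
    and "Digraph_Component.connected (with_proj \<Gamma>)"
    and "tree_2_spanner T \<Gamma>"
  shows "is_raag (bb_group \<Gamma>) \<and>
    presents (bb_group \<Gamma>) (parcs \<Gamma>) (dicks_leary_relators \<Gamma>) (edge_elem \<Gamma>) \<and>
    (\<forall>ori. orientation T ori \<longrightarrow>
      pres_simplifies (parcs \<Gamma>, dicks_leary_relators \<Gamma>)
        (ori ` uedges T,
         {word_comm (ori e) (ori f) | e f.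
            e \<in> uedges T \<and> f \<in> uedges T \<and> e \<noteq> f \<and> in_common_triangle \<Gamma> e f}) \<and>
      presents (bb_group \<Gamma>) (uedges T)
        {word_comm e f | e f.
            e \<in> uedges T \<and> f \<in> uedges T \<and> e \<noteq> f \<and> in_common_triangle \<Gamma> e f}
        (\<lambda>e. edge_elem \<Gamma> (ori e))) \<and>
    bb_group \<Gamma> \<cong> raag (dual_graph \<Gamma> T)"
proof -
  interpret A: group "raag \<Gamma>" by (rule raag_is_group)
  \<comment> \<open>Connectedness includes having a vertex, which later provides the root.\<close>
  have nonempty: "pverts \<Gamma> \<noteq> {}"
    using assms(2) by (simp add: connected_def strongly_connected_def)
  have spanner: "oriented_spanner \<Gamma> T ori" if "orientation T ori" for ori
    using assms that by (intro oriented_spanner.intro)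
  \<comment> \<open>The claims that mention no orientation are proved with an arbitrary one.\<close>
  define ori where "ori e = (SOME a. a \<in> parcs T \<and> {fst a, snd a} = e)" for e
  have "orientation T ori"
    unfolding orientation_def
  proof
    fix e assume "e \<in> uedges T"
    then obtain u v where "(u, v) \<in> parcs T" "e = {u, v}" by (auto simp: uedges_def)
    then have "\<exists>a. a \<in> parcs T \<and> {fst a, snd a} = e" by (intro exI[of _ "(u, v)"]) simp
    from someI_ex[OF this] show "ori e \<in> parcs T \<and> {fst (ori e), snd (ori e)} = e"
      by (simp only: ori_def)
  qed
  then interpret S: oriented_spanner \<Gamma> T ori by (rule spanner)
  have dual: "realizes (raag \<Gamma>) (carrier (bb_group \<Gamma>)) (pverts S.dual) (raag_relators S.dual)
      (\<lambda>e. edge_elem \<Gamma> (ori e))"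
    unfolding S.dual_verts by (rule S.realizes_dual_graph[OF nonempty])
  show ?thesis
  proof (intro conjI allI impI)
    show "is_raag (bb_group \<Gamma>)"
      by (subst bb_group_eq)
        (rule A.realizes_imp_is_raag[OF subgroup_bb_group
            dual_graph_is_graph[OF S.T.pair_graph_axioms] dual])
    show "bb_group \<Gamma> \<cong> raag (dual_graph \<Gamma> T)"
      by (subst bb_group_eq) (rule A.realizes_imp_iso_raag[OF subgroup_bb_group dual])
    show "presents (bb_group \<Gamma>) (parcs \<Gamma>) (dicks_leary_relators \<Gamma>) (edge_elem \<Gamma>)"
      using S.realizes_dicks_leary[OF nonempty] by (rule bb_group_realizes_imp_presents)
  next
    fix ori assume "orientation T ori"
    note O = spanner[OF this]
    show "pres_simplifies (parcs \<Gamma>, dicks_leary_relators \<Gamma>)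
        (ori ` uedges T,
         {word_comm (ori e) (ori f) | e f.
            e \<in> uedges T \<and> f \<in> uedges T \<and> e \<noteq> f \<and> in_common_triangle \<Gamma> e f})"
      using O nonempty by (rule oriented_spanner.spanner_simplifies)
    show "presents (bb_group \<Gamma>) (uedges T)
        {word_comm e f | e f.
            e \<in> uedges T \<and> f \<in> uedges T \<and> e \<noteq> f \<and> in_common_triangle \<Gamma> e f}
        (\<lambda>e. edge_elem \<Gamma> (ori e))"
      using O nonempty by (rule oriented_spanner.spanner_presents)
  qed
qed

end
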